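(* For every $\varepsilon\le1$ (with $\varepsilon>0$), the Local-DP EXP4 algorithm (defined in the context), run for $T$ rounds with privacy parameter $\varepsilon$ and $$\eta=\sqrt{\frac{\log N}{3TK\left(1+\frac{10\log^2(KT)}{\varepsilon^2}\right)}},\qquad \gamma=\frac{4\eta K\log(KT)}{\varepsilon},$$ is $\varepsilon$-differentially private and has worst-case expected regret at most $$O\left(\frac{\sqrt{TK\log N}\,\log(KT)}{\varepsilon}\right),$$ where the constant hidden in $O(\cdot)$ is absolute.
   Context: $K,N,T\in\mathbb N$. $[K]$ is the set of actions, $[N]$ the set of experts, $\Pi([K])$ the set of probability distributions on $[K]$; $\log$ is natural. $\operatorname{Lap}(\lambda)$ is the Laplace distribution with density $\frac1{2\lambda}e^{-|x|/\lambda}$. **Setting (bandits with expert advice).** A sequence of losses $\ell_t:[K]\to[0,1]$ and expert advice $\mu_t^j\in\Pi([K])$, $t\in[T]$, $j\in[N]$, is fixed in advance. In round $t$ the learner sees $\mu_t^1,\dots,\mu_t^N$, plays a random action $I_t\in[K]$, and observes only $\ell_t(I_t)$. **Worst-case expected regret:** $\sup_{\ell_{1:T}}\sup_{\mu_{1:T}^{1:N}}\Bigl(\mathbb E\bigl[\sum_{t=1}^T\ell_t(I_t)\bigr]-\inf_{j\in[N]}\sum_{t=1}^T\sum_{i=1}^K\mu_t^j(i)\ell_t(i)\Bigr)$, expectation over all randomness of the learner. **Differential privacy.** Expert advice is public. The algorithm is $\varepsilon$-differentially private if for every advice sequence, any two loss sequences $\ell_{1:T},\ell'_{1:T}$ (values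 in $[0,1]$) differing at exactly one time point, and any $E\subset[K]^T$, $\mathbb P[(I_1,\dots,I_T)\in E]\le e^\varepsilon\,\mathbb P[(I'_1,\dots,I'_T)\in E]$, where $I_{1:T}$, $I'_{1:T}$ are the actions played on $\ell_{1:T}$, $\ell'_{1:T}$ with the same advice. **Local-DP EXP4** (inputs $\varepsilon>0$ and $\eta,\gamma>0$). Initialize $w_1(j)=1$ for $j\in[N]$. For $t=1,\dots,T$: receive $\mu_t^1,\dots,\mu_t^N$; set $P_t(j)=w_t(j)/\sum_{j'\in[N]}w_t(j')$ and $Q_t(i)=(1-\gamma)\sum_{j=1}^NP_t(j)\mu_t^j(i)+\frac\gamma K$; draw and play $I_t\sim Q_t$; observe $\ell_t(I_t)$; let $\ell'_t(i)=\ell_t(i)+Z_t^i$ with $Z_t^i\sim\operatorname{Lap}(1/\varepsilon)$ independent over $t,i$ (only $\ell'_t(I_t)$ is used); set $\hat\ell'_t(i)=\frac{\ell'_t(i)\,\mathbb I\{I_t=i\}}{Q_t(i)}$ (equal to $0$ for $i\ne I_t$), $\tilde\ell'_t(j)=\sum_{i=1}^K\mu_t^j(i)\hat\ell'_t(i)$ for $j\in[N]$, and update $w_{t+1}(j)=w_t(j)\exp\{-\eta\tilde\ell'_t(j)\}$. *)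

theory Defs
  imports "HOL-Probability.Probability"
begin

text \<open>
  Actions, experts and rounds are numbered \<open>1..K\<close>, \<open>1..N\<close> and \<open>1..T\<close>.
  A loss sequence is a function \<open>l t i\<close> of round and action, an advice sequence a function
  \<open>mu t j i\<close> of round, expert and action; values outside these index ranges are irrelevant.
\<close>

definition prob_vectors :: "nat \<Rightarrow> (nat \<Rightarrow> real) set" where
  "prob_vectors K = {p. (\<forall>i\<in>{1..K}. 0 \<le> p i) \<and> (\<Sum>i=1..K. p i) = 1}"

definition loss_seqs :: "nat \<Rightarrow> nat \<Rightarrow> (nat \<Rightarrow> nat \<Rightarrow> real) set" where
  "loss_seqs K T = {1..T} \<rightarrow> {1..K} \<rightarrow> {0..1}"

definition advice_seqs :: "nat \<Rightarrow> nat \<Rightarrow> nat \<Rightarrow> (nat \<Rightarrow> nat \<Rightarrow> nat \<Rightarrow> real) set" where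
  "advice_seqs K N T = {1..T} \<rightarrow> {1..N} \<rightarrow> prob_vectors K"

definition laplace :: "real \<Rightarrow> real measure" where
  "laplace b = density lborel (\<lambda>x. ennreal (1 / (2 * b) * exp (- \<bar>x\<bar> / b)))"

text \<open>
  A learner is represented by the law of the list \<open>[I\<^sub>1, \<dots>, I\<^sub>T]\<close> of the actions it plays,
  as a function of the advice and the losses.
\<close>

type_synonym learner =
  "(nat \<Rightarrow> nat \<Rightarrow> nat \<Rightarrow> real) \<Rightarrow> (nat \<Rightarrow> nat \<Rightarrow> real) \<Rightarrow> nat list measure"

definition expected_regret ::
  "nat \<Rightarrow> nat \<Rightarrow> nat \<Rightarrow> learner \<Rightarrow> (nat \<Rightarrow> nat \<Rightarrow> nat \<Rightarrow> real) \<Rightarrow> (nat \<Rightarrow> nat \<Rightarrow> real) \<Rightarrow> real" where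
  "expected_regret K N T A mu l =
     (\<integral>h. (\<Sum>t=1..T. l t (h ! (t - 1))) \<partial>(A mu l))
     - (INF j\<in>{1..N}. \<Sum>t=1..T. \<Sum>i=1..K. mu t j i * l t i)"

definition worst_case_regret :: "nat \<Rightarrow> nat \<Rightarrow> nat \<Rightarrow> learner \<Rightarrow> ereal" where
  "worst_case_regret K N T A =
     (SUP l\<in>loss_seqs K T. SUP mu\<in>advice_seqs K N T. ereal (expected_regret K N T A mu l))"

definition differentially_private :: "nat \<Rightarrow> nat \<Rightarrow> nat \<Rightarrow> real \<Rightarrow> learner \<Rightarrow> bool" where
  "differentially_private K N T eps A \<longleftrightarrow>
     (\<forall>mu\<in>advice_seqs K N T. \<forall>l\<in>loss_seqs K T. \<forall>l'\<in>loss_seqs K T.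
        card {t\<in>{1..T}. \<exists>i\<in>{1..K}. l t i \<noteq> l' t i} = 1 \<longrightarrow>
        (\<forall>E \<subseteq> {h. length h = T \<and> set h \<subseteq> {1..K}}.
           measure (A mu l) E \<le> exp eps * measure (A mu l') E))"

definition exp4_P :: "nat \<Rightarrow> (nat \<Rightarrow> real) \<Rightarrow> nat \<Rightarrow> real" where
  "exp4_P N w j = w j / (\<Sum>j'=1..N. w j')"

definition exp4_Q ::
  "nat \<Rightarrow> nat \<Rightarrow> real \<Rightarrow> (nat \<Rightarrow> nat \<Rightarrow> real) \<Rightarrow> (nat \<Rightarrow> real) \<Rightarrow> nat \<Rightarrow> real" where
  "exp4_Q K N \<gamma> m w i = (1 - \<gamma>) * (\<Sum>j=1..N. exp4_P N w j * m j i) + \<gamma> / real K"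

text \<open>
  For \<open>\<gamma> > 1\<close> the vector computed by \<^const>\<open>exp4_Q\<close> can have negative entries, and then there is
  nothing to sample from. By convention the learner plays a uniformly random action in such a
  round. For \<open>0 \<le> \<gamma> \<le> 1\<close> this case never occurs.
\<close>

definition draw_action :: "nat \<Rightarrow> (nat \<Rightarrow> real) \<Rightarrow> nat measure" where
  "draw_action K q =
     (if q \<in> prob_vectors K then point_measure {1..K} (\<lambda>i. ennreal (q i))
      else uniform_count_measure {1..K})"

text \<open>
  Weight update from \<open>w\<close>, with \<open>m\<close> and \<open>l\<close> the advice and losses of the current round,
  \<open>I\<close> the action played and \<open>z\<close> the noise vector.
\<close>

definition exp4_update ::
  "nat \<Rightarrow> nat \<Rightarrow> real \<Rightarrow> real \<Rightarrow> (nat \<Rightarrow> nat \<Rightarrow> real) \<Rightarrow> (nat \<Rightarrow> real) \<Rightarrow> (nat \<Rightarrow> real)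
     \<Rightarrow> nat \<Rightarrow> (nat \<Rightarrow> real) \<Rightarrow> (nat \<Rightarrow> real)" where
  "exp4_update K N \<eta> \<gamma> m l w I z =
     (let noisy_loss = (\<lambda>i. l i + z i);
          loss_est = (\<lambda>i. noisy_loss i * of_bool (I = i) / exp4_Q K N \<gamma> m w i);
          expert_loss = (\<lambda>j. \<Sum>i=1..K. m j i * loss_est i)
      in (\<lambda>j\<in>{1..N}. w j * exp (- \<eta> * expert_loss j)))"

definition exp4_states :: "nat \<Rightarrow> ((nat \<Rightarrow> real) \<times> nat list) measure" where
  "exp4_states N = (\<Pi>\<^sub>M j\<in>{1..N}. borel) \<Otimes>\<^sub>M count_space UNIV"

primrec exp4_run ::
  "nat \<Rightarrow> nat \<Rightarrow> real \<Rightarrow> real \<Rightarrow> real \<Rightarrow> (nat \<Rightarrow> nat \<Rightarrow> nat \<Rightarrow> real) \<Rightarrow> (nat \<Rightarrow> nat \<Rightarrow> real)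
     \<Rightarrow> nat \<Rightarrow> ((nat \<Rightarrow> real) \<times> nat list) measure" where
  "exp4_run K N eps \<eta> \<gamma> mu l 0 = return (exp4_states N) (\<lambda>j\<in>{1..N}. 1, [])"
| "exp4_run K N eps \<eta> \<gamma> mu l (Suc t) =
     do {
       (w, h) \<leftarrow> exp4_run K N eps \<eta> \<gamma> mu l t;
       I \<leftarrow> draw_action K (exp4_Q K N \<gamma> (mu (Suc t)) w);
       z \<leftarrow> (\<Pi>\<^sub>M i\<in>{1..K}. laplace (1 / eps));
       return (exp4_states N) (exp4_update K N \<eta> \<gamma> (mu (Suc t)) (l (Suc t)) w I z, h @ [I])
     }"

definition local_dp_exp4 :: "nat \<Rightarrow> nat \<Rightarrow> nat \<Rightarrow> real \<Rightarrow> real \<Rightarrow> real \<Rightarrow> learner" where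
  "local_dp_exp4 K N T eps \<eta> \<gamma> mu l =
     distr (exp4_run K N eps \<eta> \<gamma> mu l T) (count_space UNIV) snd"

end

theory Submission
  imports Defs
begin

text \<open>
  Privacy is the shift bound for the Laplace density in the one round where the losses differ;
  before and after it both runs use the same kernels.

  For the regret the noise need not be truncated. Since \<open>Q \<ge> \<gamma>/K\<close>, the exponents
  \<open>\<eta> m j i / Q i\<close> are at most \<open>\<epsilon> / (4 log (KT)) \<le> \<epsilon>/2\<close>, inside the domain of the Laplace moment generating
  function. Hence the nonnegative potential \<open>ln (\<Sum>k. w k) - ln (w j)\<close>, taken together with \<open>\<eta>\<close> times the
  loss suffered so far, grows in expectation by at most
  \<open>\<eta> \<langle>\<mu>\<^sup>j, \<ell>\<rangle> + \<eta> \<gamma> + 6 K \<eta>\<^sup>2 / \<epsilon>\<^sup>2\<close> in a round. This requires \<open>\<gamma> \<le> 1/2\<close>; for larger \<open>\<gamma>\<close> the trivial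
  bound \<open>T\<close> is already of the claimed order. If \<open>N = 1\<close> or \<open>KT = 1\<close> the claimed bound is \<open>0\<close>, and then \<open>\<gamma> = 0\<close>
  and the learner plays exactly the advice.
\<close>

section \<open>The Laplace distribution\<close>

lemma sets_laplace [simp, measurable_cong]: "sets (laplace b) = sets borel"
  by (simp add: laplace_def)

lemma space_laplace [simp]: "space (laplace b) = UNIV"
  by (simp add: laplace_def)

text \<open>Reduces the Laplace law to the exponential one. At \<open>0\<close> both one-sided
  densities take the value \<open>eps\<close>, so the identity fails there; a single point is
  negligible in the integrals below.\<close>

lemma laplace_density_eq_exponential:
  fixes eps x :: real
  assumes "x \<noteq> 0"
  shows "eps / 2 * exp (- (eps * \<bar>x\<bar>))
    = (exponential_density eps x + exponential_density eps (- x)) / 2"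
  using assms by (auto simp: exponential_density_def abs_if mult.commute)

lemma nn_integral_laplace:
  assumes "eps > 0" "f \<in> borel_measurable borel"
  shows "(\<integral>\<^sup>+x. f x \<partial>laplace (1 / eps)) = (\<integral>\<^sup>+x. ennreal (eps / 2 * exp (- (eps * \<bar>x\<bar>))) * f x \<partial>lborel)"
  using assms by (simp add: laplace_def nn_integral_density mult.commute)

lemma integral_exponential_density:
  assumes "0 < (c::real)"
  shows "integrable lborel (exponential_density c)" "integral\<^sup>L lborel (exponential_density c) = 1"
proof -
  interpret prob_space "density lborel (exponential_density c)"
    by (rule prob_space_exponential_density) fact
  have "(\<integral>\<^sup>+x. ennreal (exponential_density c x) \<partial>lborel) = 1"
    using emeasure_space_1 by (simp add: emeasure_density)
  then have "has_bochner_integral lborel (exponential_density c) 1"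
    by (intro has_bochner_integral_nn_integral) (auto simp: exponential_density_def assms less_imp_le)
  then show "integrable lborel (exponential_density c)" "integral\<^sup>L lborel (exponential_density c) = 1"
    by (auto simp: has_bochner_integral_iff)
qed

text \<open>Symmetrisation: reflecting the negative half-line leaves two integrals against the
  exponential density. \<open>has_bochner_integral\<close> carries integrability along with the
  value.\<close>

lemma has_bochner_integral_laplace:
  assumes "eps > 0" and [measurable]: "f \<in> borel_measurable borel"
    and "has_bochner_integral lborel (\<lambda>x. exponential_density eps x * f x) u"
    and "has_bochner_integral lborel (\<lambda>x. exponential_density eps x * f (- x)) v"
  shows "has_bochner_integral (laplace (1 / eps)) f ((u + v) / 2 :: real)"
proof -
  have "has_bochner_integral lborel (\<lambda>x. exponential_density eps (- x) * f x) v"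
    using assms(4) lborel_has_bochner_integral_real_affine_iff
      [of "-1" "\<lambda>x. exponential_density eps (- x) * f x" v 0] by simp
  then have "has_bochner_integral lborel
      (\<lambda>x. (exponential_density eps x * f x + exponential_density eps (- x) * f x) / 2) ((u + v) / 2)"
    using assms(3) by (intro has_bochner_integral_divide_zero has_bochner_integral_add)
  moreover have "AE x in lborel. (exponential_density eps x * f x + exponential_density eps (- x) * f x) / 2
      = (eps / 2 * exp (- (eps * \<bar>x\<bar>))) * f x"
    using AE_lborel_singleton[of 0]
  proof eventually_elim
    case (elim x)
    show ?case
      unfolding laplace_density_eq_exponential[OF elim] by (simp add: algebra_simps add_divide_distrib)
  qed
  ultimately have "has_bochner_integral lborel (\<lambda>x. (eps / 2 * exp (- (eps * \<bar>x\<bar>))) *\<^sub>R f x) ((u + v) / 2)"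
    by (subst (asm) has_bochner_integral_cong_AE) auto
  then show ?thesis
    using assms(1) unfolding laplace_def
    by (intro has_bochner_integral_density) (auto simp: mult.commute)
qed

lemma prob_space_laplace:
  assumes "eps > 0" shows "prob_space (laplace (1 / eps))"
proof
  have "has_bochner_integral (laplace (1 / eps)) (\<lambda>_. 1) ((1 + 1) / 2 :: real)"
    using assms by (intro has_bochner_integral_laplace)
      (auto simp: has_bochner_integral_iff integral_exponential_density)
  then have "integrable (laplace (1 / eps)) (\<lambda>_. 1::real)" "(\<integral>x. (1::real) \<partial>laplace (1 / eps)) = 1"
    by (auto simp: has_bochner_integral_iff)
  then have "(\<integral>\<^sup>+x. ennreal 1 \<partial>laplace (1 / eps)) = ennreal 1"
    by (subst nn_integral_eq_integral) auto
  then show "emeasure (laplace (1 / eps)) (space (laplace (1 / eps))) = 1"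
    by simp
qed

text \<open>Exponential tilting: \<open>exp (c * x)\<close> times the exponential density of rate
  \<open>eps\<close> is \<open>eps / (eps - c)\<close> times the density of rate
  \<open>eps - c\<close>, which integrates to 1. The values at \<open>c = a\<close> and
  \<open>c = -a\<close> are then averaged.\<close>

lemma laplace_mgf:
  assumes "\<bar>a\<bar> < eps"
  shows "has_bochner_integral (laplace (1 / eps)) (\<lambda>x. exp (a * x)) (1 / (1 - (a / eps)\<^sup>2))"
proof -
  have *: "has_bochner_integral lborel (\<lambda>x. exponential_density eps x * exp (c * x)) (eps / (eps - c))"
    if "\<bar>c\<bar> < eps" for c
  proof -
    have "has_bochner_integral lborel (\<lambda>x. (eps / (eps - c)) * exponential_density (eps - c) x) (eps / (eps - c) * 1)"
      using that by (intro has_bochner_integral_mult_right)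
        (auto simp: has_bochner_integral_iff integral_exponential_density)
    also have "(\<lambda>x. (eps / (eps - c)) * exponential_density (eps - c) x)
        = (\<lambda>x. exponential_density eps x * exp (c * x))"
    proof
      fix x
      have "exp (- (x * (eps - c))) = exp (- (x * eps)) * exp (c * x)"
        by (simp add: exp_add[symmetric] algebra_simps)
      then show "(eps / (eps - c)) * exponential_density (eps - c) x = exponential_density eps x * exp (c * x)"
        using that by (auto simp: exponential_density_def)
    qed
    finally show ?thesis by simp
  qed
  have "has_bochner_integral (laplace (1 / eps)) (\<lambda>x. exp (a * x)) ((eps / (eps - a) + eps / (eps - - a)) / 2)"
    using assms *[of a] *[of "-a"] by (intro has_bochner_integral_laplace) auto
  also have "(eps / (eps - a) + eps / (eps - - a)) / 2 = 1 / (1 - (a / eps)\<^sup>2)"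
  proof -
    have nz: "eps - a \<noteq> 0" "eps + a \<noteq> 0" "eps \<noteq> 0" using assms by auto
    moreover have "eps\<^sup>2 - a\<^sup>2 = (eps - a) * (eps + a)" by (simp add: power2_eq_square algebra_simps)
    moreover from nz this have "eps\<^sup>2 - a\<^sup>2 \<noteq> 0" by simp
    ultimately show ?thesis
      by (simp add: divide_simps power_divide) (simp add: algebra_simps power2_eq_square)
  qed
  finally show ?thesis .
qed

lemma laplace_mean:
  assumes "eps > 0"
  shows "has_bochner_integral (laplace (1 / eps)) (\<lambda>x. x) 0"
proof -
  \<comment> \<open>The exponential law is the Erlang law with shape index \<open>0\<close>; this is
    its first moment.\<close>
  have "has_bochner_integral lborel (\<lambda>x. exponential_density eps x * x ^ 1) (fact (0 + 1) / (fact 0 * eps ^ 1))"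
    using assms nn_integral_erlang_ith_moment[of eps 0 1]
    by (intro has_bochner_integral_nn_integral) (auto simp: exponential_density_def)
  then have *: "has_bochner_integral lborel (\<lambda>x. exponential_density eps x * x) (1 / eps)"
    by simp
  then have "has_bochner_integral lborel (\<lambda>x. exponential_density eps x * - x) (- (1 / eps))"
    using has_bochner_integral_minus[OF *] by simp
  with * have "has_bochner_integral (laplace (1 / eps)) (\<lambda>x. x) ((1 / eps + - (1 / eps)) / 2)"
    using assms by (intro has_bochner_integral_laplace) auto
  then show ?thesis by simp
qed

text \<open>Translating the variable moves the shift from \<open>f\<close> into the density, where a
  displacement of at most 1 costs at most the factor \<open>exp eps\<close> pointwise. The test
  function is arbitrary so that it can stand for the whole future of the run.\<close>

lemma nn_integral_laplace_shift_le:
  assumes "eps > 0" and [measurable]: "f \<in> borel_measurable borel" and "\<bar>a - b\<bar> \<le> 1"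
  shows "(\<integral>\<^sup>+x. f (a + x) \<partial>laplace (1 / eps)) \<le> ennreal (exp eps) * (\<integral>\<^sup>+x. f (b + x) \<partial>laplace (1 / eps))"
proof -
  let ?p = "\<lambda>x. eps / 2 * exp (- (eps * \<bar>x\<bar>))"
  have shift: "(\<integral>\<^sup>+x. f (c + x) \<partial>laplace (1 / eps)) = (\<integral>\<^sup>+y. ennreal (?p (y - c)) * f y \<partial>lborel)" for c
    using nn_integral_real_affine[of "\<lambda>y. ennreal (?p (y - c)) * f y" 1 c] assms(1)
    by (simp add: nn_integral_laplace)
  have "?p (y - a) \<le> exp eps * ?p (y - b)" for y
  proof -
    have "\<bar>y - b\<bar> - \<bar>y - a\<bar> \<le> 1" using assms(3) by linarith
    then have "eps * (\<bar>y - b\<bar> - \<bar>y - a\<bar>) \<le> eps * 1"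
      using assms(1) by (intro mult_left_mono) auto
    then have "exp (- (eps * \<bar>y - a\<bar>)) \<le> exp (eps + - (eps * \<bar>y - b\<bar>))"
      by (simp add: algebra_simps)
    then have "exp (- (eps * \<bar>y - a\<bar>)) \<le> exp eps * exp (- (eps * \<bar>y - b\<bar>))"
      by (simp only: exp_add)
    then have "eps / 2 * exp (- (eps * \<bar>y - a\<bar>)) \<le> eps / 2 * (exp eps * exp (- (eps * \<bar>y - b\<bar>)))"
      using assms(1) by (intro mult_left_mono) auto
    then show ?thesis by (simp only: mult_ac)
  qed
  then have "(\<integral>\<^sup>+y. ennreal (?p (y - a)) * f y \<partial>lborel) \<le> (\<integral>\<^sup>+y. ennreal (exp eps) * (ennreal (?p (y - b)) * f y) \<partial>lborel)"
    by (intro nn_integral_mono)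
      (auto simp: ennreal_mult'[symmetric] mult.assoc[symmetric] intro!: mult_right_mono ennreal_leI)
  then show ?thesis
    unfolding shift by (simp add: nn_integral_cmult)
qed

section \<open>The run as a Markov chain\<close>

text \<open>The loss estimate vanishes off the played action, so losses and noise enter the update
  only through one number \<open>y\<close>, the noisy loss of \<open>I\<close>.\<close>

definition exp4_step ::
  "nat \<Rightarrow> nat \<Rightarrow> real \<Rightarrow> real \<Rightarrow> (nat \<Rightarrow> nat \<Rightarrow> real) \<Rightarrow> (nat \<Rightarrow> real) \<Rightarrow> nat \<Rightarrow> real \<Rightarrow> (nat \<Rightarrow> real)" where
  "exp4_step K N \<eta> \<gamma> m w I y =
     (\<lambda>j\<in>{1..N}. w j * exp (- \<eta> * (m j I * y / exp4_Q K N \<gamma> m w I)))"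

lemma exp4_update_eq_step:
  assumes "I \<in> {1..K}"
  shows "exp4_update K N \<eta> \<gamma> m l w I z = exp4_step K N \<eta> \<gamma> m w I (l I + z I)"
proof -
  have "(\<Sum>i=1..K. m j i * ((l i + z i) * of_bool (I = i) / exp4_Q K N \<gamma> m w i))
      = m j I * (l I + z I) / exp4_Q K N \<gamma> m w I" for j
  proof -
    have "(\<Sum>i=1..K. m j i * ((l i + z i) * of_bool (I = i) / exp4_Q K N \<gamma> m w i))
      = (\<Sum>i=1..K. if i = I then m j I * (l I + z I) / exp4_Q K N \<gamma> m w I else 0)"
      by (intro sum.cong) auto
    also have "\<dots> = m j I * (l I + z I) / exp4_Q K N \<gamma> m w I"
      using assms by simp
    finally show ?thesis .
  qed
  then show ?thesis
    unfolding exp4_update_def exp4_step_def Let_def by simp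
qed

text \<open>The body of the recursion in \<open>exp4_run\<close> as a transition kernel on states,
  so that privacy and regret both reduce to a statement about one round.\<close>

definition exp4_kernel ::
  "nat \<Rightarrow> nat \<Rightarrow> real \<Rightarrow> real \<Rightarrow> real \<Rightarrow> (nat \<Rightarrow> nat \<Rightarrow> real) \<Rightarrow> (nat \<Rightarrow> real)
     \<Rightarrow> (nat \<Rightarrow> real) \<times> nat list \<Rightarrow> ((nat \<Rightarrow> real) \<times> nat list) measure" where
  "exp4_kernel K N eps \<eta> \<gamma> m l = (\<lambda>(w, h).
     draw_action K (exp4_Q K N \<gamma> m w) \<bind> (\<lambda>I.
       (\<Pi>\<^sub>M i\<in>{1..K}. laplace (1 / eps)) \<bind> (\<lambda>z.
         return (exp4_states N) (exp4_update K N \<eta> \<gamma> m l w I z, h @ [I]))))"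

lemma exp4_run_Suc_kernel:
  "exp4_run K N eps \<eta> \<gamma> mu l (Suc t) =
     exp4_run K N eps \<eta> \<gamma> mu l t \<bind> exp4_kernel K N eps \<eta> \<gamma> (mu (Suc t)) (l (Suc t))"
  by (simp add: exp4_kernel_def)

section \<open>Measurability of one round\<close>

lemma exp4_Q_measurable [measurable]:
  "(\<lambda>w. exp4_Q K N \<gamma> m w i) \<in> borel_measurable (\<Pi>\<^sub>M j\<in>{1..N}. borel)"
  unfolding exp4_Q_def exp4_P_def by measurable

lemma sets_draw_action [simp, measurable_cong]:
  "sets (draw_action K q) = sets (count_space {1..K})"
  by (simp add: draw_action_def sets_point_measure sets_uniform_count_measure)

lemma space_draw_action [simp]: "space (draw_action K q) = {1..K}"
  by (simp add: draw_action_def space_point_measure space_uniform_count_measure)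

text \<open>One mass function for both branches of \<open>draw_action\<close>: sums over actions
  need no case distinction, and for \<open>K \<ge> 1\<close> the total mass is 1 whatever \<gamma>
  is.\<close>

definition draw_weight :: "nat \<Rightarrow> (nat \<Rightarrow> real) \<Rightarrow> nat \<Rightarrow> real" where
  "draw_weight K q i = (if q \<in> prob_vectors K then q i else 1 / real K)"

lemma draw_action_eq: "draw_action K q = point_measure {1..K} (\<lambda>i. ennreal (draw_weight K q i))"
  unfolding draw_action_def draw_weight_def uniform_count_measure_def by simp

lemma nn_integral_draw_action:
  "(\<integral>\<^sup>+i. f i \<partial>draw_action K q) = (\<Sum>i=1..K. ennreal (draw_weight K q i) * f i)"
  unfolding draw_action_eq by (subst nn_integral_point_measure_finite) (auto simp: mult.commute)

lemma draw_weight_nonneg: "i \<in> {1..K} \<Longrightarrow> 0 \<le> draw_weight K q i"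
  by (auto simp: draw_weight_def prob_vectors_def)

lemma sum_draw_weight: "K \<ge> 1 \<Longrightarrow> (\<Sum>i=1..K. draw_weight K q i) = 1"
proof (cases "q \<in> prob_vectors K")
  case True
  then show ?thesis by (simp add: draw_weight_def prob_vectors_def)
qed (simp add: draw_weight_def)

lemma prob_space_draw_action:
  assumes "K \<ge> 1" shows "prob_space (draw_action K q)"
proof
  have "emeasure (draw_action K q) (space (draw_action K q)) = (\<integral>\<^sup>+i. 1 \<partial>draw_action K q)"
    by simp
  also have "\<dots> = ennreal (\<Sum>i=1..K. draw_weight K q i)"
    unfolding nn_integral_draw_action mult_1_right by (intro sum_ennreal draw_weight_nonneg)
  finally show "emeasure (draw_action K q) (space (draw_action K q)) = 1"
    using sum_draw_weight[OF assms, of q] by simp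
qed

lemma draw_weight_measurable [measurable]:
  "i \<in> {1..K} \<Longrightarrow> (\<lambda>w. draw_weight K (exp4_Q K N \<gamma> m w) i) \<in> borel_measurable (\<Pi>\<^sub>M j\<in>{1..N}. borel)"
  unfolding draw_weight_def prob_vectors_def mem_Collect_eq by measurable

text \<open>There are finitely many actions, so the mass of an event is a finite sum of weights that
  depend measurably on \<open>w\<close>. This includes the uniform fallback, because membership in
  \<open>prob_vectors K\<close> is a measurable condition.\<close>

lemma draw_action_measurable [measurable]:
  assumes "K \<ge> 1"
  shows "(\<lambda>w. draw_action K (exp4_Q K N \<gamma> m w)) \<in> (\<Pi>\<^sub>M j\<in>{1..N}. borel) \<rightarrow>\<^sub>M prob_algebra (count_space {1..K})"
proof (intro measurable_prob_algebraI measurable_subprob_algebra)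
  fix A assume "A \<in> sets (count_space {1..K})"
  then have A: "A \<subseteq> {1..K}" "finite A" by (auto intro: finite_subset)
  have "emeasure (draw_action K q) A = (\<Sum>i\<in>A. ennreal (draw_weight K q i))" for q
    unfolding draw_action_eq using A by (subst emeasure_point_measure_finite) auto
  then have eq: "(\<lambda>w. emeasure (draw_action K (exp4_Q K N \<gamma> m w)) A)
      = (\<lambda>w. \<Sum>i\<in>A. ennreal (draw_weight K (exp4_Q K N \<gamma> m w) i))"
    by auto
  show "(\<lambda>w. emeasure (draw_action K (exp4_Q K N \<gamma> m w)) A) \<in> borel_measurable (\<Pi>\<^sub>M j\<in>{1..N}. borel)"
    unfolding eq
    by (intro borel_measurable_sum measurable_compose[OF draw_weight_measurable measurable_ennreal])
      (use A in auto)
qed (use prob_space_draw_action[OF assms] prob_space_imp_subprob_space in auto)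

lemma exp4_step_measurable:
  assumes "I \<in> {1..K}"
  shows "(\<lambda>(w, y). exp4_step K N \<eta> \<gamma> m w I y) \<in> (\<Pi>\<^sub>M j\<in>{1..N}. borel) \<Otimes>\<^sub>M borel \<rightarrow>\<^sub>M (\<Pi>\<^sub>M j\<in>{1..N}. borel)"
  unfolding exp4_step_def case_prod_beta
  by (rule measurable_restrict) measurable

lemma exp4_next_measurable:
  assumes "I \<in> {1..K}"
  shows "(\<lambda>((w, h), z). (exp4_update K N \<eta> \<gamma> m l w I z, h @ [I]))
    \<in> exp4_states N \<Otimes>\<^sub>M (\<Pi>\<^sub>M i\<in>{1..K}. laplace (1 / eps)) \<rightarrow>\<^sub>M exp4_states N"
proof -
  have "(\<lambda>x. (fst (fst x), l I + snd x I))
     \<in> exp4_states N \<Otimes>\<^sub>M (\<Pi>\<^sub>M i\<in>{1..K}. laplace (1 / eps)) \<rightarrow>\<^sub>M (\<Pi>\<^sub>M j\<in>{1..N}. borel) \<Otimes>\<^sub>M borel"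
    unfolding exp4_states_def using assms by measurable
  from measurable_compose[OF this exp4_step_measurable[OF assms, of N \<eta> \<gamma> m]]
  have 1: "(\<lambda>x. exp4_step K N \<eta> \<gamma> m (fst (fst x)) I (l I + snd x I))
     \<in> exp4_states N \<Otimes>\<^sub>M (\<Pi>\<^sub>M i\<in>{1..K}. laplace (1 / eps)) \<rightarrow>\<^sub>M (\<Pi>\<^sub>M j\<in>{1..N}. borel)"
    by simp
  have 2: "(\<lambda>x. snd (fst x) @ [I])
     \<in> exp4_states N \<Otimes>\<^sub>M (\<Pi>\<^sub>M i\<in>{1..K}. laplace (1 / eps)) \<rightarrow>\<^sub>M count_space UNIV"
    unfolding exp4_states_def by measurable
  show ?thesis
    unfolding case_prod_beta exp4_update_eq_step[OF assms]
    by (subst (2) exp4_states_def) (rule measurable_Pair[OF 1 2])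
qed

lemma prob_space_noise: "eps > 0 \<Longrightarrow> prob_space (\<Pi>\<^sub>M i\<in>{1..K::nat}. laplace (1 / eps))"
  by (intro prob_space_PiM prob_space_laplace)

text \<open>The actions form a finite discrete set, so joint measurability in state and action
  reduces to one fixed action at a time. There the update is an \<open>exp4_step\<close>, measurable
  jointly in weights and noise.\<close>

lemma exp4_inner_measurable:
  assumes "eps > 0"
  shows "(\<lambda>((w, h), I). (\<Pi>\<^sub>M i\<in>{1..K}. laplace (1 / eps)) \<bind> (\<lambda>z.
         return (exp4_states N) (exp4_update K N \<eta> \<gamma> m l w I z, h @ [I])))
    \<in> exp4_states N \<Otimes>\<^sub>M count_space {1..K} \<rightarrow>\<^sub>M prob_algebra (exp4_states N)"
proof -
  let ?P = "\<Pi>\<^sub>M i\<in>{1..K}. laplace (1 / eps)"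
  let ?f = "\<lambda>I x. ?P \<bind> (\<lambda>z. return (exp4_states N) (exp4_update K N \<eta> \<gamma> m l (fst x) I z, snd x @ [I]))"
  have *: "?f I \<in> exp4_states N \<rightarrow>\<^sub>M prob_algebra (exp4_states N)" if "I \<in> {1..K}" for I
    using prob_space_noise[OF assms]
      measurable_compose[OF exp4_next_measurable[OF that] measurable_return_prob_space]
    by (intro measurable_bind_prob_space2[where N = ?P] measurable_const)
       (auto simp: space_prob_algebra case_prod_beta)
  have "(\<lambda>x. ?f (snd x) (fst x)) \<in> exp4_states N \<Otimes>\<^sub>M count_space {1..K} \<rightarrow>\<^sub>M prob_algebra (exp4_states N)"
    by (rule measurable_compose_countable'[where f = "\<lambda>I x. ?f I (fst x)", OF measurable_compose[OF measurable_fst *] measurable_snd])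
      auto
  then show ?thesis
    by (simp only: case_prod_beta')
qed

lemma exp4_kernel_measurable [measurable]:
  assumes "eps > 0" "K \<ge> 1"
  shows "exp4_kernel K N eps \<eta> \<gamma> m l \<in> exp4_states N \<rightarrow>\<^sub>M prob_algebra (exp4_states N)"
proof -
  have "(\<lambda>x. draw_action K (exp4_Q K N \<gamma> m (fst x))) \<in> exp4_states N \<rightarrow>\<^sub>M prob_algebra (count_space {1..K})"
    unfolding exp4_states_def using draw_action_measurable[OF assms(2)] by measurable
  then show ?thesis
    unfolding exp4_kernel_def case_prod_beta'
    using exp4_inner_measurable[OF assms(1), of K N \<eta> \<gamma> m l]
    by (intro measurable_bind_prob_space2[where N = "count_space {1..K}"]) (simp_all only: case_prod_beta')
qed

section \<open>Expectations over one round and over the run\<close>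

lemma nn_integral_noise_component:
  assumes "eps > 0" "I \<in> {1..K::nat}" and [measurable]: "g \<in> borel_measurable borel"
  shows "(\<integral>\<^sup>+z. g (z I) \<partial>(\<Pi>\<^sub>M i\<in>{1..K}. laplace (1 / eps))) = (\<integral>\<^sup>+x. g x \<partial>laplace (1 / eps))"
proof -
  have "(\<integral>\<^sup>+x. g x \<partial>laplace (1 / eps))
      = (\<integral>\<^sup>+x. g x \<partial>distr (\<Pi>\<^sub>M i\<in>{1..K}. laplace (1 / eps)) (laplace (1 / eps)) (\<lambda>z. z I))"
    using assms(1,2) by (subst distr_PiM_component) (auto intro: prob_space_laplace)
  also have "\<dots> = (\<integral>\<^sup>+z. g (z I) \<partial>(\<Pi>\<^sub>M i\<in>{1..K}. laplace (1 / eps)))"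
    using assms(2) by (subst nn_integral_distr) measurable
  finally show ?thesis ..
qed

lemma exp4_step_in_space [simp]: "(exp4_step K N \<eta> \<gamma> m w I y, h) \<in> space (exp4_states N)"
  by (auto simp: exp4_states_def exp4_step_def space_pair_measure space_PiM)

lemma exp4_state_function_measurable:
  assumes "f \<in> borel_measurable (exp4_states N)" "I \<in> {1..K}" "(w, h) \<in> space (exp4_states N)"
  shows "(\<lambda>y. f (exp4_step K N \<eta> \<gamma> m w I y, h')) \<in> borel_measurable borel"
proof -
  have "w \<in> space (\<Pi>\<^sub>M j\<in>{1..N}. (borel :: real measure))"
    using assms(3) by (auto simp: exp4_states_def space_pair_measure)
  then have "(\<lambda>y::real. (w, y)) \<in> borel \<rightarrow>\<^sub>M (\<Pi>\<^sub>M j\<in>{1..N}. borel) \<Otimes>\<^sub>M borel" by measurable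
  from measurable_compose[OF this exp4_step_measurable[OF assms(2), of N \<eta> \<gamma> m]]
  have "(\<lambda>y. (exp4_step K N \<eta> \<gamma> m w I y, h')) \<in> borel \<rightarrow>\<^sub>M exp4_states N"
    by (auto simp: exp4_states_def intro: measurable_Pair)
  then show ?thesis by (rule measurable_compose) (rule assms(1))
qed

text \<open>Only coordinate \<open>I\<close> of the noise reaches the next state, so the product law
  collapses to one marginal, and the draw becomes a finite sum. The later estimates of a single
  round start from this formula.\<close>

lemma nn_integral_exp4_kernel:
  assumes "eps > 0" "K \<ge> 1" "f \<in> borel_measurable (exp4_states N)" "(w, h) \<in> space (exp4_states N)"
  shows "(\<integral>\<^sup>+x. f x \<partial>exp4_kernel K N eps \<eta> \<gamma> m l (w, h))
    = (\<Sum>I=1..K. ennreal (draw_weight K (exp4_Q K N \<gamma> m w) I) *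
        (\<integral>\<^sup>+x. f (exp4_step K N \<eta> \<gamma> m w I (l I + x), h @ [I]) \<partial>laplace (1 / eps)))"
proof -
  let ?P = "\<Pi>\<^sub>M i\<in>{1..K}. laplace (1 / eps)"
  let ?R = "\<lambda>I z. return (exp4_states N) (exp4_update K N \<eta> \<gamma> m l w I z, h @ [I])"
  have meas: "?R I \<in> ?P \<rightarrow>\<^sub>M subprob_algebra (exp4_states N)" if "I \<in> {1..K}" for I
    using measurable_compose[OF measurable_Pair1'[OF assms(4)] exp4_next_measurable[OF that, of N \<eta> \<gamma> m l eps]]
    by (intro measurable_compose[OF _ return_measurable]) simp
  have "?P \<bind> ?R I \<in> space (subprob_algebra (exp4_states N))" if "I \<in> {1..K}" for I
  proof -
    have "((w, h), I) \<in> space (exp4_states N \<Otimes>\<^sub>M count_space {1..K})"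
      using assms(4) that by (simp add: space_pair_measure)
    from measurable_space[OF measurable_prob_algebraD[OF exp4_inner_measurable[OF assms(1)]] this]
    show ?thesis by simp
  qed
  \<comment> \<open>On a discrete space measurability only asks that the values lie in the target
    space.\<close>
  then have "(\<lambda>I. ?P \<bind> ?R I) \<in> draw_action K (exp4_Q K N \<gamma> m w) \<rightarrow>\<^sub>M subprob_algebra (exp4_states N)"
    by (subst measurable_cong_sets[OF sets_draw_action refl]) auto
  then have "(\<integral>\<^sup>+x. f x \<partial>exp4_kernel K N eps \<eta> \<gamma> m l (w, h))
     = (\<Sum>I=1..K. ennreal (draw_weight K (exp4_Q K N \<gamma> m w) I) * (\<integral>\<^sup>+x. f x \<partial>(?P \<bind> ?R I)))"
    unfolding exp4_kernel_def prod.case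
    by (subst nn_integral_bind[OF assms(3)]) (simp_all add: nn_integral_draw_action)
  also have "(\<integral>\<^sup>+x. f x \<partial>(?P \<bind> ?R I))
      = (\<integral>\<^sup>+x. f (exp4_step K N \<eta> \<gamma> m w I (l I + x), h @ [I]) \<partial>laplace (1 / eps))" if "I \<in> {1..K}" for I
  proof -
    have "(\<lambda>x. l I + x) \<in> borel \<rightarrow>\<^sub>M borel" by measurable
    then have "(\<lambda>x. f (exp4_step K N \<eta> \<gamma> m w I (l I + x), h @ [I])) \<in> borel_measurable borel"
      by (rule measurable_compose) (rule exp4_state_function_measurable[OF assms(3) that assms(4)])
    from nn_integral_noise_component[OF assms(1) that this]
    show ?thesis
      by (subst nn_integral_bind[OF assms(3) meas[OF that]])
        (simp add: exp4_update_eq_step[OF that] nn_integral_return assms(3))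
  qed
  then have "(\<Sum>I=1..K. ennreal (draw_weight K (exp4_Q K N \<gamma> m w) I) * (\<integral>\<^sup>+x. f x \<partial>(?P \<bind> ?R I)))
     = (\<Sum>I=1..K. ennreal (draw_weight K (exp4_Q K N \<gamma> m w) I) *
        (\<integral>\<^sup>+x. f (exp4_step K N \<eta> \<gamma> m w I (l I + x), h @ [I]) \<partial>laplace (1 / eps)))"
    by (intro sum.cong) auto
  finally show ?thesis .
qed

lemma exp4_run_in_prob_algebra:
  assumes "eps > 0" "K \<ge> 1"
  shows "exp4_run K N eps \<eta> \<gamma> mu l t \<in> space (prob_algebra (exp4_states N))"
proof (induction t)
  case 0
  have "((\<lambda>j\<in>{1..N}. 1), []) \<in> space (exp4_states N)"
    by (simp add: exp4_states_def space_pair_measure space_PiM)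
  then show ?case by (simp add: space_prob_algebra prob_space_return)
next
  case (Suc t)
  then show ?case
    unfolding exp4_run_Suc_kernel space_prob_algebra
    using prob_space_bind'[OF Suc exp4_kernel_measurable[OF assms]]
      sets_bind'[OF Suc exp4_kernel_measurable[OF assms]] by simp
qed

lemma sets_exp4_run:
  assumes "eps > 0" "K \<ge> 1"
  shows "sets (exp4_run K N eps \<eta> \<gamma> mu l t) = sets (exp4_states N)"
  using exp4_run_in_prob_algebra[OF assms] by (simp add: space_prob_algebra)

lemma space_exp4_run:
  assumes "eps > 0" "K \<ge> 1"
  shows "space (exp4_run K N eps \<eta> \<gamma> mu l t) = space (exp4_states N)"
  by (rule sets_eq_imp_space_eq[OF sets_exp4_run[OF assms]])

lemma nn_integral_exp4_run_Suc:
  assumes "eps > 0" "K \<ge> 1" "f \<in> borel_measurable (exp4_states N)"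
  shows "(\<integral>\<^sup>+x. f x \<partial>exp4_run K N eps \<eta> \<gamma> mu l (Suc t))
    = (\<integral>\<^sup>+x. \<integral>\<^sup>+y. f y \<partial>exp4_kernel K N eps \<eta> \<gamma> (mu (Suc t)) (l (Suc t)) x \<partial>exp4_run K N eps \<eta> \<gamma> mu l t)"
  unfolding exp4_run_Suc_kernel
  using measurable_prob_algebraD[OF exp4_kernel_measurable[OF assms(1,2)]]
  by (intro nn_integral_bind[OF assms(3)])
    (simp add: measurable_cong_sets[OF sets_exp4_run[OF assms(1,2)] refl])

section \<open>Privacy\<close>

text \<open>Both kernels draw the action with the same weights, and given the action the two losses
  merely translate the noise, by at most 1. The shift bound therefore applies to each
  summand.\<close>

lemma nn_integral_exp4_kernel_le:
  assumes "eps > 0" "K \<ge> 1" "f \<in> borel_measurable (exp4_states N)" "x \<in> space (exp4_states N)"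
    and l: "l \<in> {1..K} \<rightarrow> {0..1}" "l' \<in> {1..K} \<rightarrow> {0..1}"
  shows "(\<integral>\<^sup>+y. f y \<partial>exp4_kernel K N eps \<eta> \<gamma> m l x)
    \<le> ennreal (exp eps) * (\<integral>\<^sup>+y. f y \<partial>exp4_kernel K N eps \<eta> \<gamma> m l' x)"
proof -
  obtain w h where x: "x = (w, h)" by fastforce
  have "(\<integral>\<^sup>+x. f (exp4_step K N \<eta> \<gamma> m w I (l I + x), h @ [I]) \<partial>laplace (1 / eps))
     \<le> ennreal (exp eps) * (\<integral>\<^sup>+x. f (exp4_step K N \<eta> \<gamma> m w I (l' I + x), h @ [I]) \<partial>laplace (1 / eps))"
    if "I \<in> {1..K}" for I
  proof (rule nn_integral_laplace_shift_le[OF assms(1)])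
    show "(\<lambda>y. f (exp4_step K N \<eta> \<gamma> m w I y, h @ [I])) \<in> borel_measurable borel"
      using assms(3,4) that unfolding x by (intro exp4_state_function_measurable)
    have "l I \<in> {0..1}" "l' I \<in> {0..1}" using l that by blast+
    then show "\<bar>l I - l' I\<bar> \<le> 1" by auto
  qed
  then have "(\<Sum>I=1..K. ennreal (draw_weight K (exp4_Q K N \<gamma> m w) I) *
        (\<integral>\<^sup>+x. f (exp4_step K N \<eta> \<gamma> m w I (l I + x), h @ [I]) \<partial>laplace (1 / eps)))
     \<le> (\<Sum>I=1..K. ennreal (draw_weight K (exp4_Q K N \<gamma> m w) I) * (ennreal (exp eps) *
        (\<integral>\<^sup>+x. f (exp4_step K N \<eta> \<gamma> m w I (l' I + x), h @ [I]) \<partial>laplace (1 / eps))))"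
    by (intro sum_mono mult_left_mono) auto
  also have "\<dots> = ennreal (exp eps) * (\<Sum>I=1..K. ennreal (draw_weight K (exp4_Q K N \<gamma> m w) I) *
        (\<integral>\<^sup>+x. f (exp4_step K N \<eta> \<gamma> m w I (l' I + x), h @ [I]) \<partial>laplace (1 / eps)))"
    by (simp add: sum_distrib_left mult_ac)
  finally show ?thesis
    using assms(1-4) unfolding x by (simp add: nn_integral_exp4_kernel)
qed

lemma nn_integral_exp4_kernel_cong:
  assumes "eps > 0" "K \<ge> 1" "f \<in> borel_measurable (exp4_states N)" "x \<in> space (exp4_states N)"
    and "\<And>i. i \<in> {1..K} \<Longrightarrow> l i = l' i"
  shows "(\<integral>\<^sup>+y. f y \<partial>exp4_kernel K N eps \<eta> \<gamma> m l x) = (\<integral>\<^sup>+y. f y \<partial>exp4_kernel K N eps \<eta> \<gamma> m l' x)"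
proof -
  obtain w h where x: "x = (w, h)" by fastforce
  show ?thesis
    using assms unfolding x by (simp add: nn_integral_exp4_kernel)
qed

text \<open>Induction on the rounds for all test functions at once: the expectation of
  \<open>f\<close> over the last round is a function of the state before it, and serves as test
  function for the earlier rounds. Only round \<open>s\<close> costs a factor. The conjunct
  \<open>s > 0\<close> keeps the factor at 1 for \<open>s = 0\<close>, since rounds start at
  1.\<close>

lemma nn_integral_exp4_run_le:
  assumes "eps > 0" "K \<ge> 1" "f \<in> borel_measurable (exp4_states N)"
    and l: "l \<in> loss_seqs K T" "l' \<in> loss_seqs K T"
    and eq: "\<And>t i. t \<in> {1..T} - {s} \<Longrightarrow> i \<in> {1..K} \<Longrightarrow> l t i = l' t i"
    and "t \<le> T"
  shows "(\<integral>\<^sup>+x. f x \<partial>exp4_run K N eps \<eta> \<gamma> mu l t)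
    \<le> ennreal (if t \<ge> s \<and> s > 0 then exp eps else 1) * (\<integral>\<^sup>+x. f x \<partial>exp4_run K N eps \<eta> \<gamma> mu l' t)"
  using assms(3,7)
proof (induction t arbitrary: f)
  case 0
  then show ?case by (cases "s = 0") simp_all
next
  case (Suc t)
  define c where "c = (if Suc t = s then exp eps else 1)"
  let ?k = "\<lambda>l x. \<integral>\<^sup>+y. f y \<partial>exp4_kernel K N eps \<eta> \<gamma> (mu (Suc t)) (l (Suc t)) x"
  have k: "?k l x \<le> ennreal c * ?k l' x" if "x \<in> space (exp4_states N)" for x
  proof (cases "Suc t = s")
    case True
    moreover have "l (Suc t) \<in> {1..K} \<rightarrow> {0..1}" "l' (Suc t) \<in> {1..K} \<rightarrow> {0..1}"
      using l Suc.prems(2) by (auto simp: loss_seqs_def Pi_iff)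
    ultimately show ?thesis
      unfolding c_def using nn_integral_exp4_kernel_le[OF assms(1,2) Suc.prems(1) that] by simp
  next
    case False
    then have "?k l x = ?k l' x"
      using Suc.prems(2) eq[of "Suc t"]
      by (intro nn_integral_exp4_kernel_cong[OF assms(1,2) Suc.prems(1) that]) auto
    then show ?thesis
      unfolding c_def using False by simp
  qed
  have meas: "?k l' \<in> borel_measurable (exp4_states N)"
    by (rule measurable_compose[OF measurable_prob_algebraD[OF exp4_kernel_measurable[OF assms(1,2)]]
      nn_integral_measurable_subprob_algebra[OF Suc.prems(1)]])
  have "(\<integral>\<^sup>+x. f x \<partial>exp4_run K N eps \<eta> \<gamma> mu l (Suc t)) = (\<integral>\<^sup>+x. ?k l x \<partial>exp4_run K N eps \<eta> \<gamma> mu l t)"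
    by (rule nn_integral_exp4_run_Suc[OF assms(1,2) Suc.prems(1)])
  \<comment> \<open>The losses of the last round are exchanged here, pointwise in the state; the
    induction hypothesis then exchanges those of the earlier rounds.\<close>
  also have "\<dots> \<le> (\<integral>\<^sup>+x. ennreal c * ?k l' x \<partial>exp4_run K N eps \<eta> \<gamma> mu l t)"
    by (intro nn_integral_mono k) (simp add: space_exp4_run[OF assms(1,2)])
  also have "\<dots> \<le> ennreal (if t \<ge> s \<and> s > 0 then exp eps else 1)
      * (\<integral>\<^sup>+x. ennreal c * ?k l' x \<partial>exp4_run K N eps \<eta> \<gamma> mu l' t)"
    using Suc.prems(2) meas by (intro Suc.IH) auto
  also have "\<dots> = ennreal (if t \<ge> s \<and> s > 0 then exp eps else 1)
      * (ennreal c * (\<integral>\<^sup>+x. ?k l' x \<partial>exp4_run K N eps \<eta> \<gamma> mu l' t))"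
    using meas by (subst nn_integral_cmult) (simp_all add: measurable_cong_sets[OF sets_exp4_run[OF assms(1,2)] refl])
  \<comment> \<open>At most one of the two factors differs from 1: if \<open>Suc t = s\<close>, the
    first \<open>t\<close> rounds have not reached \<open>s\<close>.\<close>
  also have "\<dots> = ennreal (if Suc t \<ge> s \<and> s > 0 then exp eps else 1) * (\<integral>\<^sup>+x. ?k l' x \<partial>exp4_run K N eps \<eta> \<gamma> mu l' t)"
    by (cases "Suc t = s") (auto simp: c_def)
  also have "(\<integral>\<^sup>+x. ?k l' x \<partial>exp4_run K N eps \<eta> \<gamma> mu l' t) = (\<integral>\<^sup>+x. f x \<partial>exp4_run K N eps \<eta> \<gamma> mu l' (Suc t))"
    by (rule nn_integral_exp4_run_Suc[OF assms(1,2) Suc.prems(1), symmetric])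
  finally show ?case .
qed

lemma snd_measurable_exp4_run:
  assumes "eps > 0" "K \<ge> 1"
  shows "snd \<in> exp4_run K N eps \<eta> \<gamma> mu l t \<rightarrow>\<^sub>M count_space UNIV"
  using measurable_snd
  unfolding measurable_cong_sets[OF sets_exp4_run[OF assms] refl] exp4_states_def .

lemma prob_space_local_dp_exp4:
  assumes "eps > 0" "K \<ge> 1"
  shows "prob_space (local_dp_exp4 K N T eps \<eta> \<gamma> mu l)"
  unfolding local_dp_exp4_def
  using exp4_run_in_prob_algebra[OF assms]
  by (intro prob_space.prob_space_distr snd_measurable_exp4_run[OF assms]) (simp add: space_prob_algebra)

lemma nn_integral_local_dp_exp4:
  assumes "eps > 0" "K \<ge> 1"
  shows "(\<integral>\<^sup>+h. f h \<partial>local_dp_exp4 K N T eps \<eta> \<gamma> mu l) = (\<integral>\<^sup>+x. f (snd x) \<partial>exp4_run K N eps \<eta> \<gamma> mu l T)"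
  unfolding local_dp_exp4_def
  by (rule nn_integral_distr[OF snd_measurable_exp4_run[OF assms]]) simp

text \<open>The comparison of runs is applied to the indicator of \<open>E\<close> on the history
  component of the state; neighbouring loss sequences differ in a single round
  \<open>s\<close>.\<close>

lemma local_dp_exp4_differentially_private:
  assumes "eps > 0" "K \<ge> 1"
  shows "differentially_private K N T eps (local_dp_exp4 K N T eps \<eta> \<gamma>)"
  unfolding differentially_private_def
proof (intro ballI impI allI)
  fix mu l l' E
  assume l: "l \<in> loss_seqs K T" "l' \<in> loss_seqs K T"
    and "card {t\<in>{1..T}. \<exists>i\<in>{1..K}. l t i \<noteq> l' t i} = 1"
  then obtain s where "{t\<in>{1..T}. \<exists>i\<in>{1..K}. l t i \<noteq> l' t i} = {s}"
    by (auto simp: card_1_singleton_iff)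
  then have eq: "l t i = l' t i" if "t \<in> {1..T} - {s}" "i \<in> {1..K}" for t i
    using that by blast
  let ?A = "local_dp_exp4 K N T eps \<eta> \<gamma> mu"
  have *: "emeasure (?A l) E = (\<integral>\<^sup>+x. indicator E (snd x) \<partial>exp4_run K N eps \<eta> \<gamma> mu l T)" for l
  proof -
    have "emeasure (?A l) E = (\<integral>\<^sup>+h. indicator E h \<partial>?A l)"
      by (simp add: local_dp_exp4_def)
    then show ?thesis unfolding nn_integral_local_dp_exp4[OF assms] .
  qed
  have "(\<lambda>x. indicator E (snd x)) \<in> borel_measurable (exp4_states N)"
    unfolding exp4_states_def by measurable
  from nn_integral_exp4_run_le[OF assms this l eq order_refl]
  have "emeasure (?A l) E \<le> ennreal (if s \<le> T \<and> 0 < s then exp eps else 1) * emeasure (?A l') E"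
    unfolding * by blast
  also have "\<dots> \<le> ennreal (exp eps) * emeasure (?A l') E"
    using assms(1) by (intro mult_right_mono ennreal_leI) auto
  finally have "emeasure (?A l) E \<le> ennreal (exp eps) * emeasure (?A l') E" .
  moreover have "finite_measure (?A l)" "finite_measure (?A l')"
    using prob_space_local_dp_exp4[OF assms] by (auto intro: prob_space.finite_measure)
  ultimately show "measure (?A l) E \<le> exp eps * measure (?A l') E"
    by (simp add: finite_measure.emeasure_eq_measure ennreal_mult'[symmetric])
qed

section \<open>Regret\<close>

text \<open>Supermartingale argument: \<Phi> plus \<alpha> times the accumulated loss, minus the
  accumulated \<open>c\<close>, does not increase in expectation, and the final \<Phi> is dropped
  because it is nonnegative. Positivity of the weights is the only property of the state that
  \<open>drift\<close> may use. Working with nonnegative integrals keeps the integrability of \<Phi>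
  out of the argument.\<close>

lemma exp4_potential_drift:
  fixes \<Phi> :: "(nat \<Rightarrow> real) \<Rightarrow> real"
  assumes "eps > 0" "K \<ge> 1"
    and \<Phi>_meas: "\<Phi> \<in> borel_measurable (\<Pi>\<^sub>M j\<in>{1..N}. borel)"
    and \<Phi>_nonneg: "\<And>w. (\<And>j. j \<in> {1..N} \<Longrightarrow> 0 < w j) \<Longrightarrow> 0 \<le> \<Phi> w"
    and l: "l \<in> loss_seqs K T" and "0 \<le> \<alpha>" and c: "\<And>t. t \<in> {1..T} \<Longrightarrow> 0 \<le> c t"
    and drift: "\<And>t w. t < T \<Longrightarrow> (\<And>j. j \<in> {1..N} \<Longrightarrow> 0 < w j) \<Longrightarrow>
      (\<Sum>I=1..K. ennreal (draw_weight K (exp4_Q K N \<gamma> (mu (Suc t)) w) I) *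
        (\<integral>\<^sup>+x. ennreal (\<Phi> (exp4_step K N \<eta> \<gamma> (mu (Suc t)) w I (l (Suc t) I + x)) + \<alpha> * l (Suc t) I)
          \<partial>laplace (1 / eps)))
      \<le> ennreal (\<Phi> w + c (Suc t))"
  shows "\<alpha> * (\<integral>h. (\<Sum>t=1..T. l t (h ! (t - 1))) \<partial>local_dp_exp4 K N T eps \<eta> \<gamma> mu l)
    \<le> \<Phi> (\<lambda>j\<in>{1..N}. 1) + (\<Sum>t=1..T. c t)"
proof -
  define good where "good = (\<lambda>t (w :: nat \<Rightarrow> real, h :: nat list).
    length h = t \<and> set h \<subseteq> {1..K} \<and> (\<forall>j\<in>{1..N}. 0 < w j))"
  define L where "L = (\<lambda>t h. \<alpha> * (\<Sum>s=1..t. l s (h ! (s - 1))))"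
  \<comment> \<open>The value \<open>\<infinity>\<close> off the good states makes the bound below also assert that the run stays in them.\<close>
  define F where "F = (\<lambda>t x. if good t x then ennreal (\<Phi> (fst x) + L t (snd x)) else \<infinity>)"
  have F_meas: "F t \<in> borel_measurable (exp4_states N)" for t
  proof -
    have [measurable]: "\<Phi> \<in> borel_measurable (\<Pi>\<^sub>M j\<in>{1..N}. borel)" by fact
    have [measurable]: "L t \<in> borel_measurable (count_space UNIV)" by simp
    define H where "H = (\<lambda>h. length h = t \<and> set h \<subseteq> {1..K})"
    define W where "W = (\<lambda>w :: nat \<Rightarrow> real. \<forall>j\<in>{1..N}. 0 < w j)"
    have [measurable]: "Measurable.pred (count_space UNIV) H" by simp
    have [measurable]: "Measurable.pred (\<Pi>\<^sub>M j\<in>{1..N}. borel) W"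
      unfolding W_def by (intro pred_intros_finite) measurable
    have good: "good t = (\<lambda>x. H (snd x) \<and> W (fst x))"
      by (auto simp: good_def H_def W_def fun_eq_iff)
    show ?thesis
      unfolding F_def exp4_states_def good by measurable
  qed
  have L_nonneg: "0 \<le> L t h" if "t \<le> T" "length h = t" "set h \<subseteq> {1..K}" for t h
  proof -
    have "0 \<le> l s (h ! (s - 1))" if "s \<in> {1..t}" for s
    proof -
      have "s - 1 < length h" using that \<open>length h = t\<close> by auto
      then have "h ! (s - 1) \<in> {1..K}" using \<open>set h \<subseteq> {1..K}\<close> nth_mem by blast
      moreover have "s \<in> {1..T}" using that \<open>t \<le> T\<close> by auto
      ultimately have "l s (h ! (s - 1)) \<in> {0..1}" using l unfolding loss_seqs_def by blast
      then show ?thesis by simp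
    qed
    then show ?thesis unfolding L_def using \<open>0 \<le> \<alpha>\<close> by (intro mult_nonneg_nonneg sum_nonneg) auto
  qed
  have kernel: "(\<integral>\<^sup>+y. F (Suc t) y \<partial>exp4_kernel K N eps \<eta> \<gamma> (mu (Suc t)) (l (Suc t)) x) \<le> F t x + ennreal (c (Suc t))"
    if "t < T" "x \<in> space (exp4_states N)" for t x
  proof (cases "good t x")
    case False
    then show ?thesis by (simp add: F_def)
  next
    case True
    obtain w h where x: "x = (w, h)" by fastforce
    have wh: "(w, h) \<in> space (exp4_states N)" using that(2) x by simp
    let ?q = "draw_weight K (exp4_Q K N \<gamma> (mu (Suc t)) w)"
    let ?u = "\<lambda>I x. exp4_step K N \<eta> \<gamma> (mu (Suc t)) w I (l (Suc t) I + x)"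
    have w: "0 < w j" if "j \<in> {1..N}" for j using True that by (auto simp: good_def x)
    have h: "length h = t" "set h \<subseteq> {1..K}" using True by (auto simp: good_def x)
    have A: "0 \<le> L t h" using L_nonneg \<open>t < T\<close> h by simp
    \<comment> \<open>The past loss \<open>L t h\<close> is constant during the round. It splits off
      as a separate \<open>ennreal\<close> summand because both parts are nonnegative.\<close>
    have F_eq: "F (Suc t) (?u I y, h @ [I])
        = ennreal (\<Phi> (?u I y) + \<alpha> * l (Suc t) I) + ennreal (L t h)" if "I \<in> {1..K}" for I y
    proof -
      have pos: "\<And>j. j \<in> {1..N} \<Longrightarrow> 0 < ?u I y j" using w by (simp add: exp4_step_def)
      have "good (Suc t) (?u I y, h @ [I])"
        using h that pos by (simp add: good_def)
      moreover have "L (Suc t) (h @ [I]) = L t h + \<alpha> * l (Suc t) I"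
        using h by (auto simp: L_def nth_append distrib_left intro!: sum.cong)
      moreover have "0 \<le> \<Phi> (?u I y) + \<alpha> * l (Suc t) I"
      proof -
        have "l (Suc t) I \<in> {0..1}" using l \<open>t < T\<close> that unfolding loss_seqs_def Pi_iff by auto
        then show ?thesis using \<Phi>_nonneg[OF pos] \<open>0 \<le> \<alpha>\<close> by (intro add_nonneg_nonneg mult_nonneg_nonneg) auto
      qed
      ultimately show ?thesis using A by (simp add: F_def ennreal_plus[symmetric] algebra_simps del: ennreal_plus)
    qed
    have int: "(\<integral>\<^sup>+y. F (Suc t) (?u I y, h @ [I]) \<partial>laplace (1 / eps))
        = (\<integral>\<^sup>+y. ennreal (\<Phi> (?u I y) + \<alpha> * l (Suc t) I) \<partial>laplace (1 / eps)) + ennreal (L t h)" if "I \<in> {1..K}" for I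
    proof -
      have "(\<lambda>x. \<Phi> (fst x)) \<in> borel_measurable (exp4_states N)"
        unfolding exp4_states_def by (rule measurable_compose[OF measurable_fst \<Phi>_meas])
      from exp4_state_function_measurable[OF this that wh]
      have [measurable]: "(\<lambda>y. \<Phi> (exp4_step K N \<eta> \<gamma> (mu (Suc t)) w I y)) \<in> borel_measurable borel"
        by simp
      have [measurable]: "(\<lambda>y. \<Phi> (?u I y)) \<in> borel_measurable borel"
        by (rule measurable_compose[of "\<lambda>y. l (Suc t) I + y"]) measurable
      interpret prob_space "laplace (1 / eps)" by (rule prob_space_laplace) fact
      show ?thesis
        unfolding F_eq[OF that] using emeasure_space_1
        by (subst nn_integral_add) auto
    qed
    have "(\<integral>\<^sup>+y. F (Suc t) y \<partial>exp4_kernel K N eps \<eta> \<gamma> (mu (Suc t)) (l (Suc t)) x)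
      = (\<Sum>I=1..K. ennreal (?q I) * (\<integral>\<^sup>+y. F (Suc t) (?u I y, h @ [I]) \<partial>laplace (1 / eps)))"
      unfolding x by (rule nn_integral_exp4_kernel[OF assms(1,2) F_meas wh])
    also have "\<dots> = (\<Sum>I=1..K. ennreal (?q I) * (\<integral>\<^sup>+y. ennreal (\<Phi> (?u I y) + \<alpha> * l (Suc t) I) \<partial>laplace (1 / eps)))
        + (\<Sum>I=1..K. ennreal (?q I)) * ennreal (L t h)"
      unfolding sum_distrib_right sum.distrib[symmetric]
      by (intro sum.cong) (simp_all add: int distrib_left)
    also have "(\<Sum>I=1..K. ennreal (?q I)) = 1"
      using sum_draw_weight[OF assms(2)] by (subst sum_ennreal) (auto intro!: draw_weight_nonneg)
    also have "(\<Sum>I=1..K. ennreal (?q I) * (\<integral>\<^sup>+y. ennreal (\<Phi> (?u I y) + \<alpha> * l (Suc t) I) \<partial>laplace (1 / eps)))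
        + 1 * ennreal (L t h) \<le> ennreal (\<Phi> w + c (Suc t)) + ennreal (L t h)"
      using drift[OF \<open>t < T\<close> w] by (simp add: add_right_mono)
    also have "\<dots> = F t x + ennreal (c (Suc t))"
      using True A \<Phi>_nonneg[OF w] c[of "Suc t"] \<open>t < T\<close> by (simp add: F_def x add_ac)
    finally show ?thesis .
  qed
  have run: "(\<integral>\<^sup>+x. F t x \<partial>exp4_run K N eps \<eta> \<gamma> mu l t) \<le> ennreal (\<Phi> (\<lambda>j\<in>{1..N}. 1) + (\<Sum>s=1..t. c s))"
    if "t \<le> T" for t
    using that
  proof (induction t)
    case 0
    define w\<^sub>0 :: "nat \<Rightarrow> real" where "w\<^sub>0 = (\<lambda>j\<in>{1..N}. 1)"
    have "(w\<^sub>0, []) \<in> space (exp4_states N)" and pos: "\<forall>j\<in>{1..N}. 0 < w\<^sub>0 j"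
      by (simp_all add: exp4_states_def space_pair_measure space_PiM w\<^sub>0_def)
    then have "(\<integral>\<^sup>+x. F 0 x \<partial>exp4_run K N eps \<eta> \<gamma> mu l 0) = F 0 (w\<^sub>0, [])"
      unfolding exp4_run.simps w\<^sub>0_def[symmetric] by (intro nn_integral_return F_meas)
    also have "\<dots> = ennreal (\<Phi> w\<^sub>0)"
      using pos by (simp add: F_def good_def L_def)
    finally show ?case
      unfolding w\<^sub>0_def[symmetric] by simp
  next
    case (Suc t)
    interpret prob_space "exp4_run K N eps \<eta> \<gamma> mu l t"
      using exp4_run_in_prob_algebra[OF assms(1,2)] by (simp add: space_prob_algebra)
    have "(\<integral>\<^sup>+x. F (Suc t) x \<partial>exp4_run K N eps \<eta> \<gamma> mu l (Suc t))
      = (\<integral>\<^sup>+x. \<integral>\<^sup>+y. F (Suc t) y \<partial>exp4_kernel K N eps \<eta> \<gamma> (mu (Suc t)) (l (Suc t)) x \<partial>exp4_run K N eps \<eta> \<gamma> mu l t)"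
      by (rule nn_integral_exp4_run_Suc[OF assms(1,2) F_meas])
    also have "\<dots> \<le> (\<integral>\<^sup>+x. F t x + ennreal (c (Suc t)) \<partial>exp4_run K N eps \<eta> \<gamma> mu l t)"
      using Suc.prems by (intro nn_integral_mono kernel) (auto simp: space_exp4_run[OF assms(1,2)])
    also have "\<dots> = (\<integral>\<^sup>+x. F t x \<partial>exp4_run K N eps \<eta> \<gamma> mu l t) + ennreal (c (Suc t))"
      using F_meas[of t] emeasure_space_1
      by (subst nn_integral_add) (simp_all add: measurable_cong_sets[OF sets_exp4_run[OF assms(1,2)] refl])
    also have "\<dots> \<le> ennreal (\<Phi> (\<lambda>j\<in>{1..N}. 1) + (\<Sum>s=1..t. c s)) + ennreal (c (Suc t))"
      by (rule add_right_mono[OF Suc.IH[OF Suc_leD[OF Suc.prems]]])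
    also have "\<dots> = ennreal (\<Phi> (\<lambda>j\<in>{1..N}. 1) + (\<Sum>s=1..Suc t. c s))"
      using c Suc.prems by (subst ennreal_plus[symmetric]) (auto simp: add_ac intro!: add_nonneg_nonneg sum_nonneg \<Phi>_nonneg)
    finally show ?case .
  qed
  have "(\<integral>\<^sup>+h. ennreal (L T h) \<partial>local_dp_exp4 K N T eps \<eta> \<gamma> mu l)
      = (\<integral>\<^sup>+x. ennreal (L T (snd x)) \<partial>exp4_run K N eps \<eta> \<gamma> mu l T)"
    by (rule nn_integral_local_dp_exp4[OF assms(1,2)])
  \<comment> \<open>\<open>F T\<close> dominates \<open>L T\<close>: on good states since \<Phi> is
    nonnegative, elsewhere since it is infinite.\<close>
  also have "\<dots> \<le> (\<integral>\<^sup>+x. F T x \<partial>exp4_run K N eps \<eta> \<gamma> mu l T)"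
    by (intro nn_integral_mono) (auto simp: F_def good_def intro!: ennreal_leI \<Phi>_nonneg)
  also note run[OF order_refl]
  finally have "(\<integral>h. L T h \<partial>local_dp_exp4 K N T eps \<eta> \<gamma> mu l) \<le> \<Phi> (\<lambda>j\<in>{1..N}. 1) + (\<Sum>t=1..T. c t)"
    using c by (intro integral_real_bounded) (auto intro!: add_nonneg_nonneg sum_nonneg \<Phi>_nonneg)
  then show ?thesis unfolding L_def by simp
qed

lemma expected_regret_le:
  assumes "N \<ge> 1"
    and "\<And>j. j \<in> {1..N} \<Longrightarrow>
      (\<integral>h. (\<Sum>t=1..T. l t (h ! (t - 1))) \<partial>A mu l) \<le> (\<Sum>t=1..T. \<Sum>i=1..K. mu t j i * l t i) + B"
  shows "expected_regret K N T A mu l \<le> B"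
proof -
  have "(\<integral>h. (\<Sum>t=1..T. l t (h ! (t - 1))) \<partial>A mu l) - B \<le> (INF j\<in>{1..N}. \<Sum>t=1..T. \<Sum>i=1..K. mu t j i * l t i)"
    using assms(1,2) by (intro cINF_greatest) (auto simp: algebra_simps)
  then show ?thesis unfolding expected_regret_def by linarith
qed

text \<open>The drift lemma with zero potential and \<alpha> = 1. It serves the two cases that use
  no potential: the trivial bound by the horizon and the degenerate parameters.\<close>

lemma exp4_expected_loss_le:
  assumes "eps > 0" "K \<ge> 1" "l \<in> loss_seqs K T" "\<And>t. t \<in> {1..T} \<Longrightarrow> 0 \<le> c t"
    and "\<And>t w. t < T \<Longrightarrow> (\<And>j. j \<in> {1..N} \<Longrightarrow> 0 < w j) \<Longrightarrow>
      (\<Sum>I=1..K. draw_weight K (exp4_Q K N \<gamma> (mu (Suc t)) w) I * l (Suc t) I) \<le> c (Suc t)"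
  shows "(\<integral>h. (\<Sum>t=1..T. l t (h ! (t - 1))) \<partial>local_dp_exp4 K N T eps \<eta> \<gamma> mu l) \<le> (\<Sum>t=1..T. c t)"
proof -
  interpret prob_space "laplace (1 / eps)" by (rule prob_space_laplace) fact
  have "(\<Sum>I=1..K. ennreal (draw_weight K (exp4_Q K N \<gamma> (mu (Suc t)) w) I) * ennreal (l (Suc t) I))
      \<le> ennreal (c (Suc t))" if "t < T" "\<And>j. j \<in> {1..N} \<Longrightarrow> 0 < w j" for t w
  proof -
    have "l (Suc t) I \<in> {0..1}" if "I \<in> {1..K}" for I
      using assms(3) that \<open>t < T\<close> unfolding loss_seqs_def Pi_iff by auto
    then have "(\<Sum>I=1..K. ennreal (draw_weight K (exp4_Q K N \<gamma> (mu (Suc t)) w) I) * ennreal (l (Suc t) I))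
       = (\<Sum>I=1..K. ennreal (draw_weight K (exp4_Q K N \<gamma> (mu (Suc t)) w) I * l (Suc t) I))"
      by (intro sum.cong) (simp_all add: draw_weight_nonneg ennreal_mult)
    also have "\<dots> = ennreal (\<Sum>I=1..K. draw_weight K (exp4_Q K N \<gamma> (mu (Suc t)) w) I * l (Suc t) I)"
      using \<open>\<And>I. I \<in> {1..K} \<Longrightarrow> l (Suc t) I \<in> {0..1}\<close>
      by (intro sum_ennreal mult_nonneg_nonneg draw_weight_nonneg) auto
    finally show ?thesis using assms(5)[OF that] by (simp add: ennreal_leI)
  qed
  then show ?thesis
    using exp4_potential_drift[OF assms(1,2), of "\<lambda>_. 0" N l T 1 c \<gamma> mu \<eta>] assms(3,4) emeasure_space_1
    by simp
qed

section \<open>Exponential weights, uniform exploration and the drift of one round\<close>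

lemma exp4_P_nonneg: "(\<And>k. k \<in> {1..N} \<Longrightarrow> 0 < w k) \<Longrightarrow> j \<in> {1..N} \<Longrightarrow> 0 \<le> exp4_P N w j"
  unfolding exp4_P_def by (intro divide_nonneg_nonneg sum_nonneg) (auto simp: less_imp_le)

lemma sum_exp4_P:
  assumes "N \<ge> 1" "\<And>k. k \<in> {1..N} \<Longrightarrow> 0 < w k"
  shows "(\<Sum>j=1..N. exp4_P N w j) = 1"
proof -
  have "0 < (\<Sum>k=1..N. w k)" using assms by (intro sum_pos) auto
  then show ?thesis unfolding exp4_P_def sum_divide_distrib[symmetric] by simp
qed

lemma exp4_mixture_in_prob_vectors:
  assumes "N \<ge> 1" "\<And>k. k \<in> {1..N} \<Longrightarrow> 0 < w k" "m \<in> {1..N} \<rightarrow> prob_vectors K"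
  shows "(\<lambda>i. \<Sum>j=1..N. exp4_P N w j * m j i) \<in> prob_vectors K"
proof -
  have m: "0 \<le> m j i" if "j \<in> {1..N}" "i \<in> {1..K}" for i j
    using assms(3) that unfolding prob_vectors_def by blast
  have ms: "(\<Sum>i=1..K. m j i) = 1" if "j \<in> {1..N}" for j
    using assms(3) that unfolding prob_vectors_def by blast
  have "(\<Sum>i=1..K. \<Sum>j=1..N. exp4_P N w j * m j i) = (\<Sum>j=1..N. exp4_P N w j * (\<Sum>i=1..K. m j i))"
    unfolding sum_distrib_left by (rule sum.swap)
  also have "\<dots> = (\<Sum>j=1..N. exp4_P N w j)" by (intro sum.cong) (simp_all only: ms mult_1_right)
  also have "\<dots> = 1" by (rule sum_exp4_P[OF assms(1,2)])
  finally show ?thesis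
    using m exp4_P_nonneg[of N w] assms(2)
    unfolding prob_vectors_def by (auto intro!: sum_nonneg mult_nonneg_nonneg)
qed

text \<open>A convex combination of the mixed advice and the uniform vector. For these \<gamma> the
  fallback of \<open>draw_action\<close> does not occur, so \<open>draw_weight\<close> is
  \<open>exp4_Q\<close> itself on the actions.\<close>

lemma exp4_Q_in_prob_vectors:
  assumes "K \<ge> 1" "N \<ge> 1" "\<And>k. k \<in> {1..N} \<Longrightarrow> 0 < w k" "m \<in> {1..N} \<rightarrow> prob_vectors K" "0 \<le> \<gamma>" "\<gamma> \<le> 1"
  shows "exp4_Q K N \<gamma> m w \<in> prob_vectors K"
proof -
  have "\<forall>i\<in>{1..K}. 0 \<le> (\<Sum>j=1..N. exp4_P N w j * m j i)" "(\<Sum>i=1..K. \<Sum>j=1..N. exp4_P N w j * m j i) = 1"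
    using exp4_mixture_in_prob_vectors[OF assms(2-4)] unfolding prob_vectors_def by simp_all
  then show ?thesis
    using assms(1,5,6) unfolding prob_vectors_def exp4_Q_def
    by (simp add: sum.distrib sum_distrib_left[symmetric])
qed

text \<open>By \<open>laplace_mgf\<close> the left side is the expectation of
  \<open>exp (- a * (b + Z))\<close> for Laplace noise \<open>Z\<close>. With \<beta> the square of
  \<open>a / eps\<close>, the quadratic remainder of \<open>exp (- (a * b))\<close> costs one
  \<beta>, since \<open>a * b \<le> a / eps\<close> for \<open>eps \<le> 1\<close>, and the
  denominator \<open>1 - \<beta>\<close> costs two more.\<close>

lemma laplace_exp_bound:
  fixes a b eps :: real
  assumes "0 < eps" "eps \<le> 1" "0 \<le> a" "a \<le> eps / 2" "0 \<le> b" "b \<le> 1"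
  shows "exp (- (a * b)) / (1 - (a / eps)\<^sup>2) \<le> 1 - a * b + 3 * (a / eps)\<^sup>2"
proof -
  define \<beta> where "\<beta> = (a / eps)\<^sup>2"
  have "a / eps \<le> 1 / 2" using assms by (simp add: divide_simps)
  then have "\<beta> \<le> (1 / 2)\<^sup>2" unfolding \<beta>_def using assms by (intro power_mono) auto
  then have \<beta>: "0 \<le> \<beta>" "\<beta> \<le> 1 / 2"
    using zero_le_power2[of "a / eps", folded \<beta>_def] by (simp_all add: power2_eq_square)
  define x where "x = a * b"
  have x: "0 \<le> x" unfolding x_def using assms by simp
  have "x \<le> a * 1" unfolding x_def using assms by (intro mult_left_mono) auto
  also have "a \<le> a / eps" using assms by (simp add: divide_simps mult_left_le)
  finally have "x\<^sup>2 \<le> \<beta>" unfolding \<beta>_def using x by (intro power_mono) auto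
  have "exp (- x) = 1 / exp x" by (simp add: exp_minus divide_inverse)
  also have "\<dots> \<le> 1 / (1 + x)" using x exp_ge_add_one_self[of x] by (intro divide_left_mono) auto
  also have "\<dots> \<le> 1 - x + x\<^sup>2"
  proof -
    have "(1 - x + x\<^sup>2) * (1 + x) = 1 + x ^ 3" by (simp add: algebra_simps power2_eq_square power3_eq_cube)
    then have "1 \<le> (1 - x + x\<^sup>2) * (1 + x)" using x by simp
    then show ?thesis using x by (simp add: pos_divide_le_eq)
  qed
  finally have e: "exp (- x) \<le> 1 - x + \<beta>" using \<open>x\<^sup>2 \<le> \<beta>\<close> by linarith
  have "exp (- x) \<le> 1" using x by simp
  \<comment> \<open>This product is the excess of
    \<open>(exp (- x) + 2 * \<beta>) * (1 - \<beta>)\<close> over \<open>exp (- x)\<close>; its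
    second factor is nonnegative because
    \<open>2 - 2 * \<beta> \<ge> 1 \<ge> exp (- x)\<close>.\<close>
  then have "0 \<le> \<beta> * (2 - 2 * \<beta> - exp (- x))" using \<beta> by (intro mult_nonneg_nonneg) linarith+
  then have "exp (- x) \<le> (exp (- x) + 2 * \<beta>) * (1 - \<beta>)" by (simp add: algebra_simps)
  then have "exp (- x) / (1 - \<beta>) \<le> exp (- x) + 2 * \<beta>" using \<beta> by (simp add: pos_divide_le_eq)
  then show ?thesis using e unfolding x_def \<beta>_def by linarith
qed

text \<open>For positive weights this is minus the logarithm of \<open>exp4_P N w j\<close>, the
  relative entropy of the point mass at \<open>j\<close> with respect to
  \<open>exp4_P N w\<close>.\<close>

definition expert_potential :: "nat \<Rightarrow> nat \<Rightarrow> (nat \<Rightarrow> real) \<Rightarrow> real" where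
  "expert_potential N j w = ln ((\<Sum>k=1..N. w k) / w j)"

lemma expert_potential_measurable:
  "j \<in> {1..N} \<Longrightarrow> expert_potential N j \<in> borel_measurable (\<Pi>\<^sub>M j\<in>{1..N}. borel)"
  unfolding expert_potential_def by measurable

lemma expert_potential_nonneg:
  assumes "j \<in> {1..N}" "\<And>k. k \<in> {1..N} \<Longrightarrow> 0 < w k"
  shows "0 \<le> expert_potential N j w"
proof -
  have "w j \<le> (\<Sum>k=1..N. w k)"
    using assms by (intro member_le_sum) (auto simp: less_imp_le)
  then show ?thesis
    using assms unfolding expert_potential_def by (intro ln_ge_zero) (simp add: pos_le_divide_eq)
qed

text \<open>The normaliser is multiplied by \<open>?S\<close>, the mean of
  \<open>exp (- d k)\<close> under \<open>exp4_P N w\<close>. The inequality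
  \<open>ln ?S \<le> ?S - 1\<close> removes the logarithm and leaves exponentials whose expectation
  can be taken term by term.\<close>

lemma expert_potential_update_le:
  fixes d :: "nat \<Rightarrow> real"
  assumes j: "j \<in> {1..N}" and w: "\<And>k. k \<in> {1..N} \<Longrightarrow> 0 < w k"
  shows "expert_potential N j (\<lambda>k\<in>{1..N}. w k * exp (- d k))
    \<le> expert_potential N j w + (\<Sum>k=1..N. exp4_P N w k * exp (- d k)) - 1 + d j"
proof -
  let ?W = "\<Sum>k=1..N. w k" and ?S = "\<Sum>k=1..N. exp4_P N w k * exp (- d k)"
  have W: "0 < ?W" using j w by (intro sum_pos) auto
  have S: "0 < ?S" using j w W unfolding exp4_P_def by (intro sum_pos) auto
  have "(\<Sum>k=1..N. w k * exp (- d k)) = ?W * ?S"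
    using W unfolding exp4_P_def sum_distrib_left by (intro sum.cong) auto
  then have "(\<Sum>k=1..N. w k * exp (- d k)) / (w j * exp (- d j)) = ?W / w j * ?S * exp (d j)"
    by (simp add: exp_minus field_simps)
  moreover have "0 < ?W / w j" using W w[OF j] by simp
  moreover from this S have "ln (?W / w j * ?S * exp (d j)) = ln (?W / w j) + ln ?S + d j"
    by (simp only: ln_mult_pos mult_pos_pos exp_gt_zero ln_exp)
  ultimately have "expert_potential N j (\<lambda>k\<in>{1..N}. w k * exp (- d k)) = ln (?W / w j) + ln ?S + d j"
    unfolding expert_potential_def using j by simp
  then show ?thesis
    unfolding expert_potential_def using ln_le_minus_one[OF S] by simp
qed

text \<open>The preceding bound is averaged over the noise: \<open>laplace_mgf\<close> and
  \<open>laplace_exp_bound\<close> handle the exponentials, and the linear term keeps only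
  \<open>a j * b\<close> because the noise has mean 0. The constant \<open>c\<close> makes room for
  the loss of the round. The second conclusion allows \<open>V\<close> to be multiplied by a
  probability inside \<open>ennreal\<close>.\<close>

lemma expert_potential_noisy_update_le:
  assumes eps: "0 < eps" "eps \<le> 1" and j: "j \<in> {1..N}" and w: "\<And>k. k \<in> {1..N} \<Longrightarrow> 0 < w k"
    and a: "\<And>k. k \<in> {1..N} \<Longrightarrow> 0 \<le> a k \<and> a k \<le> eps / 2" and b: "0 \<le> b" "b \<le> 1" and "0 \<le> c"
  defines "V \<equiv> expert_potential N j w + (\<Sum>k=1..N. exp4_P N w k * (3 * (a k / eps)\<^sup>2 - a k * b)) + a j * b + c"
  shows "(\<integral>\<^sup>+x. ennreal (expert_potential N j (\<lambda>k\<in>{1..N}. w k * exp (- (a k * (b + x)))) + c) \<partial>laplace (1 / eps))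
      \<le> ennreal V" (is "?I \<le> _")
    and "0 \<le> V"
proof -
  let ?u = "\<lambda>x. \<lambda>k\<in>{1..N}. w k * exp (- (a k * (b + x)))"
  \<comment> \<open>An explicit majorant whose expectation can be computed exactly; it is
    nonnegative because it lies above a nonnegative function.\<close>
  define g where "g x = expert_potential N j w + (\<Sum>k=1..N. exp4_P N w k * exp (- (a k * (b + x)))) - 1
    + a j * (b + x) + c" for x
  have g: "expert_potential N j (?u x) + c \<le> g x" for x
    unfolding g_def using expert_potential_update_le[OF j w, where d = "\<lambda>k. a k * (b + x)"] by simp
  have u: "0 \<le> expert_potential N j (?u x) + c" for x
    using expert_potential_nonneg[OF j, of "?u x"] w \<open>0 \<le> c\<close> by simp
  then have g_nonneg: "0 \<le> g x" for x using g[of x] by (rule order_trans)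
  define E where "E k = exp (- (a k * b)) / (1 - (a k / eps)\<^sup>2)" for k
  interpret prob_space "laplace (1 / eps)" by (rule prob_space_laplace) fact
  have exp_int: "has_bochner_integral (laplace (1 / eps)) (\<lambda>x. exp (- (a k * (b + x)))) (E k)" if "k \<in> {1..N}" for k
  proof -
    have "has_bochner_integral (laplace (1 / eps)) (\<lambda>x. exp (- (a k * b)) * exp (- a k * x))
        (exp (- (a k * b)) * (1 / (1 - (- a k / eps)\<^sup>2)))"
      using a[OF that] eps by (intro has_bochner_integral_mult_right laplace_mgf) auto
    then show ?thesis by (simp add: E_def exp_add[symmetric] algebra_simps)
  qed
  have const: "has_bochner_integral (laplace (1 / eps)) (\<lambda>_. r) r" for r :: real
    using prob_space by (simp add: has_bochner_integral_iff)
  have int: "has_bochner_integral (laplace (1 / eps)) g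
     (expert_potential N j w + (\<Sum>k=1..N. exp4_P N w k * E k) - 1 + a j * (b + 0) + c)"
    unfolding g_def
    by (intro has_bochner_integral_add has_bochner_integral_diff has_bochner_integral_sum
      has_bochner_integral_mult_right const exp_int laplace_mean eps)
  have "N \<ge> 1" using j by simp
  have "(\<Sum>k=1..N. exp4_P N w k * E k) \<le> (\<Sum>k=1..N. exp4_P N w k * (1 - a k * b + 3 * (a k / eps)\<^sup>2))"
    unfolding E_def using eps a b w
    by (intro sum_mono mult_left_mono laplace_exp_bound exp4_P_nonneg) auto
  also have "\<dots> = (\<Sum>k=1..N. exp4_P N w k) + (\<Sum>k=1..N. exp4_P N w k * (3 * (a k / eps)\<^sup>2 - a k * b))"
    unfolding sum.distrib[symmetric] by (intro sum.cong) (simp_all add: algebra_simps)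
  also have "(\<Sum>k=1..N. exp4_P N w k) = 1" by (rule sum_exp4_P[OF \<open>N \<ge> 1\<close> w])
  finally have le: "integral\<^sup>L (laplace (1 / eps)) g \<le> V"
    unfolding V_def has_bochner_integral_integral_eq[OF int] by simp
  have "?I \<le> (\<integral>\<^sup>+x. ennreal (g x) \<partial>laplace (1 / eps))"
    by (intro nn_integral_mono ennreal_leI g)
  also have "\<dots> = ennreal (integral\<^sup>L (laplace (1 / eps)) g)"
    using int g_nonneg by (intro nn_integral_eq_integral) (auto simp: has_bochner_integral_iff)
  also have "\<dots> \<le> ennreal V" using le by (rule ennreal_leI)
  finally show "?I \<le> ennreal V" .
  \<comment> \<open>The sign of \<open>V\<close> is not visible from its formula; it follows because
    \<open>V\<close> is at least the mean of the nonnegative \<open>g\<close>.\<close>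
  show "0 \<le> V" by (rule order_trans[OF Bochner_Integration.integral_nonneg[OF g_nonneg] le])
qed

text \<open>Importance weighting: averaging over the action with weights \<open>q\<close> cancels
  the denominator of the estimate. The first-order terms become the loss of expert \<open>j\<close>
  minus that of the mixture \<open>s\<close>; the latter cancels the learner's own loss up to the
  exploration cost \<eta> * \<gamma>. The second-order terms give the last summand.\<close>

lemma exp4_round_drift:
  assumes eps: "0 < eps" "eps \<le> 1" and K: "K \<ge> 1" and j: "j \<in> {1..N}"
    and w: "\<And>k. k \<in> {1..N} \<Longrightarrow> 0 < w k"
    and m: "m \<in> {1..N} \<rightarrow> prob_vectors K" and l: "l \<in> {1..K} \<rightarrow> {0..1}"
    and \<eta>: "0 \<le> \<eta>" and \<gamma>: "0 < \<gamma>" "\<gamma> \<le> 1 / 2" and \<eta>\<gamma>: "\<eta> * real K / \<gamma> \<le> eps / 2"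
  shows "(\<Sum>I=1..K. ennreal (draw_weight K (exp4_Q K N \<gamma> m w) I) *
      (\<integral>\<^sup>+x. ennreal (expert_potential N j (exp4_step K N \<eta> \<gamma> m w I (l I + x)) + \<eta> * l I) \<partial>laplace (1 / eps)))
    \<le> ennreal (expert_potential N j w
        + (\<eta> * (\<Sum>i=1..K. m j i * l i) + \<eta> * \<gamma> + 6 * real K * \<eta>\<^sup>2 / eps\<^sup>2))"
proof -
  define q where "q = exp4_Q K N \<gamma> m w"
  define p where "p = exp4_P N w"
  define s where "s i = (\<Sum>k=1..N. p k * m k i)" for i
  define a where "a I k = \<eta> * m k I / q I" for I k
  \<comment> \<open>The bound of \<open>expert_potential_noisy_update_le\<close> for action
    \<open>I\<close>, with \<open>c = \<eta> * l I\<close>.\<close>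
  define V where "V I = expert_potential N j w + (\<Sum>k=1..N. p k * (3 * (a I k / eps)\<^sup>2 - a I k * l I))
    + a I j * l I + \<eta> * l I" for I
  have "N \<ge> 1" using j by simp
  have q_prob: "q \<in> prob_vectors K"
    unfolding q_def using exp4_Q_in_prob_vectors[OF K \<open>N \<ge> 1\<close> w m] \<gamma> by simp
  have q_eq: "q i = (1 - \<gamma>) * s i + \<gamma> / real K" for i
    unfolding q_def s_def p_def exp4_Q_def by simp
  have p: "0 \<le> p k" if "k \<in> {1..N}" for k
    unfolding p_def using exp4_P_nonneg[OF w that] .
  have m0: "0 \<le> m k i" "m k i \<le> 1" if "k \<in> {1..N}" "i \<in> {1..K}" for k i
  proof -
    have mk: "\<forall>i\<in>{1..K}. 0 \<le> m k i" "(\<Sum>i=1..K. m k i) = 1"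
      using m that(1) unfolding prob_vectors_def by blast+
    then show "0 \<le> m k i" using that(2) by blast
    have "m k i \<le> (\<Sum>i=1..K. m k i)" using mk(1) that(2) by (intro member_le_sum) auto
    then show "m k i \<le> 1" using mk(2) by simp
  qed
  have s: "0 \<le> s i" if "i \<in> {1..K}" for i
    unfolding s_def using that by (intro sum_nonneg mult_nonneg_nonneg p m0) auto
  have q_ge: "\<gamma> / real K \<le> q i" if "i \<in> {1..K}" for i
    unfolding q_eq using s[OF that] \<gamma> by simp
  have q_pos: "0 < q i" if "i \<in> {1..K}" for i
    using q_ge[OF that] \<gamma>(1) K by (smt (verit) divide_pos_pos of_nat_0_less_iff One_nat_def Suc_le_eq)
  \<comment> \<open>Here \<open>\<gamma> \<le> 1 / 2\<close> enters; the factor 2 turns the 3 of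
    \<open>laplace_exp_bound\<close> into the 6 of the claim.\<close>
  have s_le: "s i \<le> 2 * q i" if "i \<in> {1..K}" for i
  proof -
    have "1 / 2 * s i \<le> (1 - \<gamma>) * s i" using s[OF that] \<gamma> by (intro mult_right_mono) auto
    moreover have "0 \<le> \<gamma> / real K" using \<gamma> by simp
    ultimately show ?thesis unfolding q_eq by simp
  qed
  \<comment> \<open>Exploration keeps the exponents small enough for the moment generating function:
    no \<open>q I\<close> is below \<open>\<gamma> / K\<close>.\<close>
  have a: "0 \<le> a I k \<and> a I k \<le> eps / 2" if "I \<in> {1..K}" "k \<in> {1..N}" for I k
  proof -
    have "\<eta> * m k I / q I \<le> \<eta> * 1 / (\<gamma> / real K)"
      using q_ge[OF that(1)] q_pos[OF that(1)] m0[OF that(2,1)] \<eta> \<gamma> K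
      by (intro frac_le mult_left_mono mult_nonneg_nonneg) auto
    also have "\<dots> \<le> eps / 2" using \<eta>\<gamma> by simp
    finally show ?thesis
      using q_pos[OF that(1)] m0[OF that(2,1)] \<eta> by (simp add: a_def)
  qed
  have l0: "0 \<le> l i" "l i \<le> 1" if "i \<in> {1..K}" for i
    using l that by (auto simp: Pi_iff)
  have step: "exp4_step K N \<eta> \<gamma> m w I y = (\<lambda>k\<in>{1..N}. w k * exp (- (a I k * y)))" for I y
    unfolding exp4_step_def a_def q_def by (simp add: mult.assoc)
  have V: "(\<integral>\<^sup>+x. ennreal (expert_potential N j (exp4_step K N \<eta> \<gamma> m w I (l I + x)) + \<eta> * l I) \<partial>laplace (1 / eps))
      \<le> ennreal (V I)" "0 \<le> V I" if "I \<in> {1..K}" for I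
    unfolding step V_def p_def
    using eps j w a[OF that] l0[OF that] \<eta>
    by (intro expert_potential_noisy_update_le; simp)+
  have qV: "q I * V I \<le> q I * expert_potential N j w + (\<eta> * (m j I * l I) + \<eta> * \<gamma> / real K + 6 * \<eta>\<^sup>2 / eps\<^sup>2)"
    if I: "I \<in> {1..K}" for I
  proof -
    \<comment> \<open>One factor \<open>q I\<close> cancels against the square of
      \<open>a I k\<close>. What remains is at most 2, because the mean of the squared advice is at
      most \<open>s I\<close> and \<open>s I \<le> 2 * q I\<close>.\<close>
    have "q I * (\<Sum>k=1..N. p k * (3 * (a I k / eps)\<^sup>2))
        = 3 / eps\<^sup>2 * (\<eta>\<^sup>2 * ((\<Sum>k=1..N. p k * (m k I)\<^sup>2) / q I))"
      unfolding a_def sum_distrib_left sum_divide_distrib using q_pos[OF I] eps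
      by (intro sum.cong) (auto simp: field_simps power2_eq_square)
    also have "\<dots> \<le> 3 / eps\<^sup>2 * (\<eta>\<^sup>2 * 2)"
    proof -
      have "(m k I)\<^sup>2 \<le> m k I" if "k \<in> {1..N}" for k
        using m0[OF that I] by (simp add: power2_eq_square mult_left_le)
      then have "(\<Sum>k=1..N. p k * (m k I)\<^sup>2) \<le> s I"
        unfolding s_def using p by (intro sum_mono mult_left_mono) auto
      then have "(\<Sum>k=1..N. p k * (m k I)\<^sup>2) / q I \<le> 2"
        using s_le[OF I] q_pos[OF I] by (simp add: divide_le_eq)
      then show ?thesis by (intro mult_left_mono) auto
    qed
    finally have quad: "q I * (\<Sum>k=1..N. p k * (3 * (a I k / eps)\<^sup>2)) \<le> 6 * \<eta>\<^sup>2 / eps\<^sup>2" by simp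
    have lin: "q I * (\<Sum>k=1..N. p k * (a I k * l I)) = \<eta> * l I * s I"
      unfolding a_def s_def sum_distrib_left using q_pos[OF I] by (intro sum.cong) auto
    \<comment> \<open>The difference is \<gamma> times \<open>1 / K - s I\<close>.\<close>
    have "q I - s I \<le> \<gamma> / real K"
      unfolding q_eq using s[OF I] \<gamma> by (simp add: algebra_simps)
    then have "l I * (q I - s I) \<le> l I * (\<gamma> / real K)"
      using l0[OF I] by (intro mult_left_mono)
    also have "\<dots> \<le> 1 * (\<gamma> / real K)"
      using l0[OF I] \<gamma> by (intro mult_right_mono) auto
    finally have "\<eta> * (l I * (q I - s I)) \<le> \<eta> * (1 * (\<gamma> / real K))"
      using \<eta> by (intro mult_left_mono)
    then have expl: "\<eta> * l I * q I - \<eta> * l I * s I \<le> \<eta> * \<gamma> / real K"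
      by (simp add: algebra_simps)
    have "q I * V I = q I * expert_potential N j w + q I * (\<Sum>k=1..N. p k * (3 * (a I k / eps)\<^sup>2))
        - q I * (\<Sum>k=1..N. p k * (a I k * l I)) + q I * a I j * l I + \<eta> * l I * q I"
      unfolding V_def by (simp add: algebra_simps sum_subtractf)
    also have "q I * a I j = \<eta> * m j I" unfolding a_def using q_pos[OF I] by simp
    finally show ?thesis using quad expl unfolding lin by (simp add: mult_ac)
  qed
  have "(\<Sum>I=1..K. ennreal (draw_weight K q I) *
      (\<integral>\<^sup>+x. ennreal (expert_potential N j (exp4_step K N \<eta> \<gamma> m w I (l I + x)) + \<eta> * l I) \<partial>laplace (1 / eps)))
     \<le> (\<Sum>I=1..K. ennreal (q I * V I))"
  proof (intro sum_mono)
    fix I assume I: "I \<in> {1..K}"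
    show "ennreal (draw_weight K q I) *
      (\<integral>\<^sup>+x. ennreal (expert_potential N j (exp4_step K N \<eta> \<gamma> m w I (l I + x)) + \<eta> * l I) \<partial>laplace (1 / eps))
      \<le> ennreal (q I * V I)"
      using q_pos[OF I] q_prob V[OF I] by (simp add: ennreal_mult draw_weight_def mult_left_mono)
  qed
  also have "\<dots> = ennreal (\<Sum>I=1..K. q I * V I)"
    using V q_pos by (intro sum_ennreal mult_nonneg_nonneg) (auto simp: less_imp_le)
  also have "\<dots> \<le> ennreal (expert_potential N j w
        + (\<eta> * (\<Sum>i=1..K. m j i * l i) + \<eta> * \<gamma> + 6 * real K * \<eta>\<^sup>2 / eps\<^sup>2))"
  proof (rule ennreal_leI)
    have "(\<Sum>I=1..K. q I * V I) \<le> (\<Sum>I=1..K. q I * expert_potential N j w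
        + (\<eta> * (m j I * l I) + \<eta> * \<gamma> / real K + 6 * \<eta>\<^sup>2 / eps\<^sup>2))"
      by (intro sum_mono qV)
    also have "\<dots> = (\<Sum>I=1..K. q I) * expert_potential N j w
        + (\<eta> * (\<Sum>i=1..K. m j i * l i) + \<eta> * \<gamma> + 6 * real K * \<eta>\<^sup>2 / eps\<^sup>2)"
      using K by (simp add: sum.distrib sum_distrib_left sum_distrib_right)
    also have "(\<Sum>I=1..K. q I) = 1" using q_prob by (simp add: prob_vectors_def)
    finally show "(\<Sum>I=1..K. q I * V I) \<le> expert_potential N j w
        + (\<eta> * (\<Sum>i=1..K. m j i * l i) + \<eta> * \<gamma> + 6 * real K * \<eta>\<^sup>2 / eps\<^sup>2)"
      by simp
  qed
  finally show ?thesis unfolding q_def .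
qed

section \<open>Regret against a fixed expert, in the general and the degenerate cases\<close>

lemma advice_round:
  "mu \<in> advice_seqs K N T \<Longrightarrow> t < T \<Longrightarrow> mu (Suc t) \<in> {1..N} \<rightarrow> prob_vectors K"
  unfolding advice_seqs_def by (auto simp: Pi_iff)

lemma loss_round:
  "l \<in> loss_seqs K T \<Longrightarrow> t < T \<Longrightarrow> l (Suc t) \<in> {1..K} \<rightarrow> {0..1}"
  unfolding loss_seqs_def by (auto simp: Pi_iff)

text \<open>The round drifts are summed and divided by \<eta>. All weights start at 1, so the
  initial potential is \<open>ln N\<close>.\<close>

lemma exp4_regret_le:
  assumes eps: "0 < eps" "eps \<le> 1" and K: "K \<ge> 1" and N: "N \<ge> 1"
    and \<eta>: "0 < \<eta>" and \<gamma>: "0 < \<gamma>" "\<gamma> \<le> 1 / 2" and \<eta>\<gamma>: "\<eta> * real K / \<gamma> \<le> eps / 2"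
    and mu: "mu \<in> advice_seqs K N T" and l: "l \<in> loss_seqs K T"
  shows "expected_regret K N T (local_dp_exp4 K N T eps \<eta> \<gamma>) mu l
    \<le> ln (real N) / \<eta> + real T * (\<gamma> + 6 * real K * \<eta> / eps\<^sup>2)"
proof (rule expected_regret_le[OF N])
  fix j assume j: "j \<in> {1..N}"
  define c where "c t = \<eta> * (\<Sum>i=1..K. mu t j i * l t i) + \<eta> * \<gamma> + 6 * real K * \<eta>\<^sup>2 / eps\<^sup>2" for t
  have c: "0 \<le> c t" if "t \<in> {1..T}" for t
  proof -
    have "mu t j \<in> prob_vectors K" "l t \<in> {1..K} \<rightarrow> {0..1}"
      using mu l that j unfolding advice_seqs_def loss_seqs_def by (auto simp: Pi_iff)
    then show ?thesis
      unfolding c_def prob_vectors_def using \<eta> \<gamma>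
      by (intro add_nonneg_nonneg mult_nonneg_nonneg divide_nonneg_nonneg sum_nonneg) (auto simp: Pi_iff)
  qed
  have "\<eta> * (\<integral>h. (\<Sum>t=1..T. l t (h ! (t - 1))) \<partial>local_dp_exp4 K N T eps \<eta> \<gamma> mu l)
      \<le> expert_potential N j (\<lambda>j\<in>{1..N}. 1) + (\<Sum>t=1..T. c t)"
  proof (rule exp4_potential_drift[OF eps(1) K expert_potential_measurable[OF j] expert_potential_nonneg[OF j] l _ c])
    fix t w assume "t < T" and w: "\<And>k. k \<in> {1..N} \<Longrightarrow> 0 < (w k :: real)"
    show "(\<Sum>I=1..K. ennreal (draw_weight K (exp4_Q K N \<gamma> (mu (Suc t)) w) I) *
        (\<integral>\<^sup>+x. ennreal (expert_potential N j (exp4_step K N \<eta> \<gamma> (mu (Suc t)) w I (l (Suc t) I + x)) + \<eta> * l (Suc t) I)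
          \<partial>laplace (1 / eps)))
      \<le> ennreal (expert_potential N j w + c (Suc t))"
      unfolding c_def
      using exp4_round_drift[OF eps K j w advice_round[OF mu \<open>t < T\<close>] loss_round[OF l \<open>t < T\<close>] _ \<gamma> \<eta>\<gamma>] \<eta>
      by simp
  qed (use \<eta> in auto)
  also have "expert_potential N j (\<lambda>j\<in>{1..N}. 1) = ln (real N)"
    using j by (simp add: expert_potential_def)
  also have "(\<Sum>t=1..T. c t) = \<eta> * (\<Sum>t=1..T. \<Sum>i=1..K. mu t j i * l t i)
      + real T * (\<eta> * \<gamma> + 6 * real K * \<eta>\<^sup>2 / eps\<^sup>2)"
    unfolding c_def by (simp add: sum.distrib sum_distrib_left distrib_left)
  also have "ln (real N) + (\<eta> * (\<Sum>t=1..T. \<Sum>i=1..K. mu t j i * l t i)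
      + real T * (\<eta> * \<gamma> + 6 * real K * \<eta>\<^sup>2 / eps\<^sup>2))
     = \<eta> * ((\<Sum>t=1..T. \<Sum>i=1..K. mu t j i * l t i) + (ln (real N) / \<eta> + real T * (\<gamma> + 6 * real K * \<eta> / eps\<^sup>2)))"
    using \<eta> by (simp add: field_simps power2_eq_square)
  finally show "(\<integral>h. (\<Sum>t=1..T. l t (h ! (t - 1))) \<partial>local_dp_exp4 K N T eps \<eta> \<gamma> mu l)
      \<le> (\<Sum>t=1..T. \<Sum>i=1..K. mu t j i * l t i) + (ln (real N) / \<eta> + real T * (\<gamma> + 6 * real K * \<eta> / eps\<^sup>2))"
    using \<eta> by (simp only: mult_le_cancel_left_pos)
qed

text \<open>A round costs the learner at most 1 and an expert at least 0. Since
  \<open>draw_weight\<close> sums to 1 in both branches, this covers every \<eta> and \<gamma>, even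
  rounds with uniform fallback.\<close>

lemma exp4_regret_le_horizon:
  assumes "0 < eps" "K \<ge> 1" "N \<ge> 1" and mu: "mu \<in> advice_seqs K N T" and l: "l \<in> loss_seqs K T"
  shows "expected_regret K N T (local_dp_exp4 K N T eps \<eta> \<gamma>) mu l \<le> real T"
proof (rule expected_regret_le[OF assms(3)])
  fix j assume j: "j \<in> {1..N}"
  have "(\<integral>h. (\<Sum>t=1..T. l t (h ! (t - 1))) \<partial>local_dp_exp4 K N T eps \<eta> \<gamma> mu l) \<le> (\<Sum>t=1..T. 1)"
  proof (rule exp4_expected_loss_le[OF assms(1,2) l])
    fix t w assume "t < T"
    have "(\<Sum>I=1..K. draw_weight K (exp4_Q K N \<gamma> (mu (Suc t)) w) I * l (Suc t) I)
        \<le> (\<Sum>I=1..K. draw_weight K (exp4_Q K N \<gamma> (mu (Suc t)) w) I * 1)"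
      using loss_round[OF l \<open>t < T\<close>] by (intro sum_mono mult_left_mono draw_weight_nonneg) (auto simp: Pi_iff)
    then show "(\<Sum>I=1..K. draw_weight K (exp4_Q K N \<gamma> (mu (Suc t)) w) I * l (Suc t) I) \<le> 1"
      using sum_draw_weight[OF assms(2)] by simp
  qed auto
  moreover have "0 \<le> (\<Sum>t=1..T. \<Sum>i=1..K. mu t j i * l t i)"
  proof (intro sum_nonneg mult_nonneg_nonneg)
    fix t i assume ti: "t \<in> {1..T}" "i \<in> {1..K}"
    then have "mu t j \<in> prob_vectors K" "l t i \<in> {0..1}"
      using mu l j unfolding advice_seqs_def loss_seqs_def by (auto simp: Pi_iff)
    then show "0 \<le> mu t j i" "0 \<le> l t i" using ti unfolding prob_vectors_def by auto
  qed
  ultimately show "(\<integral>h. (\<Sum>t=1..T. l t (h ! (t - 1))) \<partial>local_dp_exp4 K N T eps \<eta> \<gamma> mu l)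
      \<le> (\<Sum>t=1..T. \<Sum>i=1..K. mu t j i * l t i) + real T"
    by simp
qed

text \<open>Without exploration the learner plays the mixed advice, which here is the advice of
  \<open>j\<close>: for \<open>N = 1\<close> there is no other expert, for \<open>K = 1\<close> only
  one probability vector.\<close>

lemma exp4_regret_nonpos:
  assumes "0 < eps" "K \<ge> 1" "N = 1 \<or> K = 1" and N: "N \<ge> 1"
    and mu: "mu \<in> advice_seqs K N T" and l: "l \<in> loss_seqs K T"
  shows "expected_regret K N T (local_dp_exp4 K N T eps \<eta> 0) mu l \<le> 0"
proof (rule expected_regret_le[OF N])
  fix j assume j: "j \<in> {1..N}"
  have "(\<integral>h. (\<Sum>t=1..T. l t (h ! (t - 1))) \<partial>local_dp_exp4 K N T eps \<eta> 0 mu l)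
      \<le> (\<Sum>t=1..T. \<Sum>i=1..K. mu t j i * l t i)"
  proof (rule exp4_expected_loss_le[OF assms(1,2) l])
    fix t assume "t \<in> {1..T}"
    then show "0 \<le> (\<Sum>i=1..K. mu t j i * l t i)"
      using mu l j unfolding advice_seqs_def loss_seqs_def prob_vectors_def
      by (intro sum_nonneg mult_nonneg_nonneg) (auto simp: Pi_iff)
  next
    fix t w assume "t < T" and w: "\<And>k. k \<in> {1..N} \<Longrightarrow> 0 < (w k :: real)"
    note m = advice_round[OF mu \<open>t < T\<close>]
    have Q: "exp4_Q K N 0 (mu (Suc t)) w \<in> prob_vectors K"
      using exp4_Q_in_prob_vectors[OF assms(2) N w m, where \<gamma> = 0] by simp
    have "mu (Suc t) j \<in> prob_vectors K" using m j by blast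
    have "exp4_Q K N 0 (mu (Suc t)) w i = mu (Suc t) j i" if "i \<in> {1..K}" for i
      using assms(3)
    proof
      assume "N = 1"
      then show ?thesis using w[of 1] j by (simp add: exp4_Q_def exp4_P_def)
    next
      assume "K = 1"
      then show ?thesis using \<open>mu (Suc t) j \<in> prob_vectors K\<close> Q that by (simp add: prob_vectors_def)
    qed
    then show "(\<Sum>I=1..K. draw_weight K (exp4_Q K N 0 (mu (Suc t)) w) I * l (Suc t) I)
        \<le> (\<Sum>i=1..K. mu (Suc t) j i * l (Suc t) i)"
      using Q by (intro sum_mono) (simp add: draw_weight_def)
  qed
  then show "(\<integral>h. (\<Sum>t=1..T. l t (h ! (t - 1))) \<partial>local_dp_exp4 K N T eps \<eta> 0 mu l)
      \<le> (\<Sum>t=1..T. \<Sum>i=1..K. mu t j i * l t i) + 0"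
    by simp
qed

section \<open>Worst case and tuning of the parameters\<close>

lemma worst_case_regret_le:
  assumes "\<And>l mu. l \<in> loss_seqs K T \<Longrightarrow> mu \<in> advice_seqs K N T \<Longrightarrow> expected_regret K N T A mu l \<le> B"
  shows "worst_case_regret K N T A \<le> ereal B"
  unfolding worst_case_regret_def using assms by (intro SUP_least) simp

text \<open>In the main case each term is at most a multiple of \<open>R * x\<close>: 7 from
  \<open>ln N / \<eta>\<close>, 6/5 from exploration and 27/10 from the second-order term, in total
  10.9, which is rounded up to 11.\<close>

lemma local_dp_exp4_regret_bound:
  fixes K N T :: nat and eps \<eta> \<gamma> :: real
  assumes K: "K \<ge> 1" and N: "N \<ge> 1" and T: "T \<ge> 1" and eps: "0 < eps" "eps \<le> 1"
    and \<eta>_def: "\<eta> = sqrt (ln (real N) /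
             (3 * real T * real K * (1 + 10 * (ln (real K * real T))\<^sup>2 / eps\<^sup>2)))"
    and \<gamma>_def: "\<gamma> = 4 * \<eta> * real K * ln (real K * real T) / eps"
    and l: "l \<in> loss_seqs K T" and mu: "mu \<in> advice_seqs K N T"
  shows "expected_regret K N T (local_dp_exp4 K N T eps \<eta> \<gamma>) mu l
    \<le> 11 * (sqrt (real T * real K * ln (real N)) * ln (real K * real T) / eps)"
\<comment> \<open>In these cases the claimed bound is exactly 0, so no constant can absorb an
  error.\<close>
proof (cases "N = 1 \<or> K * T = 1")
  case True
  then have "\<gamma> = 0" by (auto simp: \<gamma>_def \<eta>_def)
  moreover have "N = 1 \<or> K = 1" using True by auto
  ultimately have "expected_regret K N T (local_dp_exp4 K N T eps \<eta> \<gamma>) mu l \<le> 0"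
    using exp4_regret_nonpos[OF eps(1) K _ N mu l] by simp
  also have "0 = 11 * (sqrt (real T * real K * ln (real N)) * ln (real K * real T) / eps)"
    using True by auto
  finally show ?thesis .
next
  case False
  define L where "L = ln (real K * real T)"
  define x where "x = L / eps"
  \<comment> \<open>The part of the root in \<eta> that depends on \<open>x\<close>. For
    \<open>x \<ge> 2 / 3\<close> its square \<open>3 + 30 * x\<^sup>2\<close> lies between the
    squares of \<open>5 * x\<close> and \<open>7 * x\<close>.\<close>
  define D where "D = sqrt (3 * (1 + 10 * x\<^sup>2))"
  define R where "R = sqrt (real T * real K * ln (real N))"
  have KT: "0 < real T" "0 < real K" using K T by simp_all
  have n: "0 < ln (real N)" using False N by simp
  have R: "0 < R" "R * R = real T * real K * ln (real N)"
    unfolding R_def using n KT by simp_all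
  \<comment> \<open>Excluding \<open>K * T = 1\<close> bounds \<open>L\<close>, and with
    \<open>eps \<le> 1\<close> also \<open>x\<close>, below by 2/3; this lets constants be absorbed
    into multiples of \<open>x\<close>.\<close>
  have "K * T \<noteq> 0" "K * T \<noteq> 1" using False K T by simp_all
  then have "2 \<le> K * T" by linarith
  then have "2 \<le> real K * real T" by (metis of_nat_le_iff of_nat_mult of_nat_numeral)
  then have "ln 2 \<le> L" unfolding L_def by simp
  then have L: "2 / 3 \<le> L" using ln2_ge_two_thirds by linarith
  have "L \<le> x" unfolding x_def using L eps by (simp add: pos_le_divide_eq mult_left_le)
  with L have x: "2 / 3 \<le> x" by linarith
  have "(2 / 3)\<^sup>2 \<le> x\<^sup>2" using x by (intro power_mono) auto
  then have x2: "4 / 9 \<le> x\<^sup>2" by (simp add: power2_eq_square)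
  have D_upper: "D \<le> 7 * x"
    unfolding D_def using x x2 by (intro real_le_lsqrt) (auto simp: power_mult_distrib)
  have D_lower: "5 * x \<le> D"
    unfolding D_def using x x2 by (intro real_le_rsqrt) (auto simp: power_mult_distrib)
  have D: "0 < D" using D_lower x by linarith
  have \<eta>: "\<eta> = R / (real T * real K * D)"
  proof -
    have "ln (real N) / (3 * real T * real K * (1 + 10 * L\<^sup>2 / eps\<^sup>2))
        = (real T * real K * ln (real N)) / ((real T * real K)\<^sup>2 * (3 * (1 + 10 * x\<^sup>2)))"
    proof -
      define y where "y = 1 + 10 * x\<^sup>2"
      have "1 + 10 * L\<^sup>2 / eps\<^sup>2 = y" "0 < y"
        by (simp_all add: y_def x_def power_divide add_pos_nonneg)
      then show ?thesis
        unfolding y_def[symmetric] using KT by (simp add: power2_eq_square)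
    qed
    then show ?thesis
      unfolding \<eta>_def L_def[symmetric] R_def D_def using KT
      by (simp add: real_sqrt_divide real_sqrt_mult)
  qed
  have \<eta>_pos: "0 < \<eta>" unfolding \<eta> using R KT D by simp
  have \<gamma>: "\<gamma> = 4 * \<eta> * real K * x" unfolding \<gamma>_def x_def L_def by simp
  have \<gamma>_pos: "0 < \<gamma>" unfolding \<gamma> using \<eta>_pos KT x by simp
  have "real T * \<gamma> = R * (4 * x / D)"
    unfolding \<gamma> \<eta> using KT by simp
  also have "\<dots> \<le> R * (4 / 5)"
    using R D_lower D by (intro mult_left_mono) (auto simp: divide_simps)
  \<comment> \<open>The factor 6/5 comes from \<open>4 / 5 = 6 / 5 * (2 / 3)\<close>.\<close>
  also have "\<dots> \<le> R * (6 / 5 * x)" using R x by (intro mult_left_mono) auto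
  finally have T\<gamma>: "real T * \<gamma> \<le> 6 / 5 * (R * x)" by simp
  have goal: "11 * (R * L / eps) = 11 * (R * x)" by (simp add: x_def)
  show ?thesis
  proof (cases "\<gamma> \<le> 1 / 2")
    case True
    have "\<eta> * real K / \<gamma> = 1 / (4 * x)" unfolding \<gamma> using \<eta>_pos KT by simp
    also have "\<dots> = eps / (4 * L)" by (simp add: x_def)
    also have "\<dots> \<le> eps / 2" using L eps by (intro divide_left_mono) auto
    finally have "\<eta> * real K / \<gamma> \<le> eps / 2" .
    from exp4_regret_le[OF eps K N \<eta>_pos \<gamma>_pos True this mu l]
    have "expected_regret K N T (local_dp_exp4 K N T eps \<eta> \<gamma>) mu l
      \<le> ln (real N) / \<eta> + real T * \<gamma> + real T * (6 * real K * \<eta> / eps\<^sup>2)"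
      by (simp add: distrib_left)
    also have "ln (real N) / \<eta> = R * D"
      unfolding \<eta> using R KT D by (simp add: field_simps)
    also have "R * D \<le> 7 * (R * x)" using mult_left_mono[OF D_upper, of R] R by simp
    also have "real T * (6 * real K * \<eta> / eps\<^sup>2) = R * (6 / D * (1 / eps\<^sup>2))"
      unfolding \<eta> using KT by simp
    also have "\<dots> \<le> R * (6 / (5 * x) * (9 / 4 * x\<^sup>2))"
    proof (intro mult_left_mono mult_mono)
      show "6 / D \<le> 6 / (5 * x)" using D_lower D x by (intro divide_left_mono) auto
      have "(2 / 3)\<^sup>2 \<le> L\<^sup>2" using L by (intro power_mono) auto
      then have "1 \<le> 9 / 4 * L\<^sup>2" by (simp add: power2_eq_square)
      then have "1 / eps\<^sup>2 \<le> 9 / 4 * L\<^sup>2 / eps\<^sup>2" by (intro divide_right_mono) auto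
      then show "1 / eps\<^sup>2 \<le> 9 / 4 * x\<^sup>2" by (simp add: x_def power_divide)
    qed (use R x in auto)
    also have "\<dots> = 27 / 10 * (R * x)" using x by (simp add: power2_eq_square)
    finally have "expected_regret K N T (local_dp_exp4 K N T eps \<eta> \<gamma>) mu l \<le> 11 * (R * x)"
      using T\<gamma> mult_pos_pos[of R x] R x by linarith
    then show ?thesis using goal unfolding R_def L_def by simp
  next
    case False
    \<comment> \<open>A large \<gamma> forces \<open>T\<close> below
      \<open>2 * T * \<gamma>\<close>, hence below \<open>12 / 5 * (R * x)\<close>, so the trivial
      bound suffices.\<close>
    have "real T * (1 / 2) \<le> real T * \<gamma>" using False by (intro mult_left_mono) auto
    then have "real T \<le> 11 * (R * x)" using T\<gamma> mult_pos_pos[of R x] R x by linarith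
    with exp4_regret_le_horizon[OF eps(1) K N mu l]
    have "expected_regret K N T (local_dp_exp4 K N T eps \<eta> \<gamma>) mu l \<le> 11 * (R * x)"
      by (rule order_trans)
    then show ?thesis using goal unfolding R_def L_def by simp
  qed
qed

theorem theorem9:
  shows "\<exists>C::real. C > 0 \<and>
    (\<forall>(K::nat) (N::nat) (T::nat) (eps::real) (\<eta>::real) (\<gamma>::real).
       K \<ge> 1 \<longrightarrow> N \<ge> 1 \<longrightarrow> T \<ge> 1 \<longrightarrow> 0 < eps \<longrightarrow> eps \<le> 1 \<longrightarrow>
       \<eta> = sqrt (ln (real N) /
             (3 * real T * real K * (1 + 10 * (ln (real K * real T))\<^sup>2 / eps\<^sup>2))) \<longrightarrow>
       \<gamma> = 4 * \<eta> * real K * ln (real K * real T) / eps \<longrightarrow>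
       differentially_private K N T eps (local_dp_exp4 K N T eps \<eta> \<gamma>) \<and>
       worst_case_regret K N T (local_dp_exp4 K N T eps \<eta> \<gamma>)
         \<le> ereal (C * (sqrt (real T * real K * ln (real N)) * ln (real K * real T) / eps)))"
proof (intro exI[of _ 11] conjI allI impI)
  fix K N T :: nat and eps \<eta> \<gamma> :: real
  assume *: "K \<ge> 1" "N \<ge> 1" "T \<ge> 1" "0 < eps" "eps \<le> 1"
    "\<eta> = sqrt (ln (real N) /
             (3 * real T * real K * (1 + 10 * (ln (real K * real T))\<^sup>2 / eps\<^sup>2)))"
    "\<gamma> = 4 * \<eta> * real K * ln (real K * real T) / eps"
  show "differentially_private K N T eps (local_dp_exp4 K N T eps \<eta> \<gamma>)"
    by (rule local_dp_exp4_differentially_private) fact+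
  show "worst_case_regret K N T (local_dp_exp4 K N T eps \<eta> \<gamma>)
      \<le> ereal (11 * (sqrt (real T * real K * ln (real N)) * ln (real K * real T) / eps))"
    by (intro worst_case_regret_le local_dp_exp4_regret_bound *)
qed simp

end
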